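(* Let $f\in\mathcal{N}(\Omega)$, $g\in\mathrm{Lip}(\Omega)$ and $p(t):=P(f+tg)$, $t\in\mathbb{R}$. Write $w_{f+tg}=e^{\varphi_t}$ for the positive eigenfunction of $\mathcal{L}_{f+tg}$ associated with $\lambda_{f+tg}$. Then $$p''(0)=\frac{d^2}{dt^2}P(f+tg)\Big|_{t=0}=\int_\Omega\Bigl(g-\int_\Omega g\,d\mu_f+\frac{d}{dt}(\varphi_t-\varphi_t\circ T)\Big|_{t=0}\Bigr)^2d\mu_f.$$
   Context: Let $(M,d_M)$ be a compact metric space with $\mathrm{diam}(M)=1$, $\Omega:=M^{\mathbb{N}}$ with metric $d(x,y)=\sum_{n\ge1}2^{-n}d_M(x_n,y_n)$, and $T:\Omega\to\Omega$ the shift. $\mathrm{Lip}(\Omega)$ is the space of real Lipschitz functions on $\Omega$. Fix a Borel probability $\nu$ on $M$ with support $M$. For $f\in\mathrm{Lip}(\Omega)$ the Ruelle operator is $\mathcal{L}_f(w)(x)=\int_M e^{f(ax)}w(ax)\,d\nu(a)$, where $ax=(a,x_1,x_2,\dots)$. By the Ruelle-Perron-Frobenius (RPF) theorem there are $\lambda_f>0$, a strictly positive $w_f\in\mathrm{Lip}(\Omega)$ and a Borel probability $\rho_f$ with $\mathcal{L}_f w_f=\lambda_f w_f$, $\mathcal{L}_f^*\rho_f=\lambda_f\rho_f$, normalized by $\int w_f\,d\rho_f=1$; these depend analytically on $f$ ($\lambda_f$ and $w_f$). The pressure is $P(f):=\log\lambda_f$. $\mathcal{N}(\Omega)$ is the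 set of $f\in\mathrm{Lip}(\Omega)$ with $\mathcal{L}_f1=1$ (normalized potentials); for $f\in\mathcal{N}(\Omega)$, $\mu_f$ is the unique Borel probability with $\mathcal{L}_f^*\mu_f=\mu_f$; it is $T$-invariant. *)

theory Defs
  imports "HOL-Probability.Probability"
begin

text \<open>
  The compact metric space \<open>M\<close> is a type \<open>'a\<close> of class \<open>metric_space\<close> with \<open>UNIV\<close> compact;
  \<open>\<Omega>\<close> is the type \<open>nat \<Rightarrow> 'a\<close>. Coordinates are indexed from 0, so \<open>x\<^sub>n\<close> is \<open>x (n - 1)\<close>.
  The library metric on \<open>nat \<Rightarrow> 'a\<close> is a different one, so \<open>\<Omega>\<close> gets its own metric; the
  topology (hence \<open>continuous_on\<close> and \<open>borel\<close>) is the library's product topology, which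
  \<open>open_iff_dist_Omega\<close> below identifies with the topology of \<open>dist_Omega\<close>.
\<close>

definition dist_Omega :: "(nat \<Rightarrow> 'a::metric_space) \<Rightarrow> (nat \<Rightarrow> 'a) \<Rightarrow> real" where
  "dist_Omega x y = (\<Sum>n. (1 / 2) ^ Suc n * dist (x n) (y n))"

definition Lip_Omega :: "((nat \<Rightarrow> 'a::metric_space) \<Rightarrow> real) set" where
  "Lip_Omega = {f. \<exists>C. \<forall>x y. \<bar>f x - f y\<bar> \<le> C * dist_Omega x y}"

definition shift :: "(nat \<Rightarrow> 'a) \<Rightarrow> (nat \<Rightarrow> 'a)" where
  "shift x = (\<lambda>n. x (Suc n))"

definition borel_probability :: "'b::topological_space measure \<Rightarrow> bool" where
  "borel_probability m \<longleftrightarrow> sets m = sets borel \<and> prob_space m"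

definition full_support :: "'b::topological_space measure \<Rightarrow> bool" where
  "full_support m \<longleftrightarrow> (\<forall>U. open U \<longrightarrow> U \<noteq> {} \<longrightarrow> emeasure m U > 0)"

text \<open>\<open>case_nat a x\<close> is the sequence \<open>a x\<^sub>1 x\<^sub>2 \<dots>\<close>.\<close>

definition ruelle ::
  "'a::metric_space measure \<Rightarrow> ((nat \<Rightarrow> 'a) \<Rightarrow> real) \<Rightarrow> ((nat \<Rightarrow> 'a) \<Rightarrow> real) \<Rightarrow> (nat \<Rightarrow> 'a) \<Rightarrow> real"
  where "ruelle nu f w x = (\<integral>a. exp (f (case_nat a x)) * w (case_nat a x) \<partial>nu)"

text \<open>\<open>rho\<close> is a Borel probability with \<open>\<L>\<^sub>f\<^sup>* rho = l rho\<close>, the dual being taken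
  with respect to the continuous functions on \<open>\<Omega>\<close>.\<close>

definition dual_eigenmeasure ::
  "'a::metric_space measure \<Rightarrow> ((nat \<Rightarrow> 'a) \<Rightarrow> real) \<Rightarrow> real \<Rightarrow> (nat \<Rightarrow> 'a) measure \<Rightarrow> bool"
  where "dual_eigenmeasure nu f l rho \<longleftrightarrow>
    borel_probability rho \<and>
    (\<forall>h. continuous_on UNIV h \<longrightarrow> (\<integral>x. ruelle nu f h x \<partial>rho) = l * (\<integral>x. h x \<partial>rho))"

definition rpf_triple ::
  "'a::metric_space measure \<Rightarrow> ((nat \<Rightarrow> 'a) \<Rightarrow> real) \<Rightarrow>
    real \<Rightarrow> ((nat \<Rightarrow> 'a) \<Rightarrow> real) \<Rightarrow> (nat \<Rightarrow> 'a) measure \<Rightarrow> bool"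
  where "rpf_triple nu f l w rho \<longleftrightarrow>
    l > 0 \<and> w \<in> Lip_Omega \<and> (\<forall>x. w x > 0) \<and>
    (\<forall>x. ruelle nu f w x = l * w x) \<and>
    dual_eigenmeasure nu f l rho \<and>
    (\<integral>x. w x \<partial>rho) = 1"

definition rpf_eigenvalue :: "'a::metric_space measure \<Rightarrow> ((nat \<Rightarrow> 'a) \<Rightarrow> real) \<Rightarrow> real" where
  "rpf_eigenvalue nu f = (THE l. \<exists>w rho. rpf_triple nu f l w rho)"

definition pressure :: "'a::metric_space measure \<Rightarrow> ((nat \<Rightarrow> 'a) \<Rightarrow> real) \<Rightarrow> real" where
  "pressure nu f = ln (rpf_eigenvalue nu f)"

definition normalized_potentials :: "'a::metric_space measure \<Rightarrow> ((nat \<Rightarrow> 'a) \<Rightarrow> real) set" where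
  "normalized_potentials nu = {f \<in> Lip_Omega. \<forall>x. ruelle nu f (\<lambda>_. 1) x = 1}"


lemma summable_dist_Omega:
  fixes x y :: "nat \<Rightarrow> 'a::metric_space"
  assumes "compact (UNIV :: 'a set)" "diameter (UNIV :: 'a set) = 1"
  shows "summable (\<lambda>n. (1 / 2) ^ Suc n * dist (x n) (y n))"
proof (rule summable_comparison_test')
  show "summable (\<lambda>n. (1 / 2 :: real) ^ Suc n)"
    by simp
  have "dist a b \<le> 1" for a b :: 'a
    using diameter_bounded_bound[OF compact_imp_bounded[OF assms(1)], of a b] assms(2) by simp
  then show "norm ((1 / 2) ^ Suc n * dist (x n) (y n)) \<le> (1 / 2) ^ Suc n" if "n \<ge> 0" for n
    by (simp add: abs_mult)
qed

lemma continuous_on_dist_Omega: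
  fixes x :: "nat \<Rightarrow> 'a::metric_space"
  assumes "compact (UNIV :: 'a set)" "diameter (UNIV :: 'a set) = 1"
  shows "continuous_on UNIV (dist_Omega x)"
proof -
  have 1: "dist a b \<le> 1" for a b :: 'a
    using diameter_bounded_bound[OF compact_imp_bounded[OF assms(1)], of a b] assms(2) by simp
  have "uniform_limit UNIV (\<lambda>N y. \<Sum>n<N. (1 / 2) ^ Suc n * dist (x n) (y n))
          (\<lambda>y. \<Sum>n. (1 / 2) ^ Suc n * dist (x n) (y n)) sequentially"
    by (rule Weierstrass_m_test[where M = "\<lambda>n. (1 / 2) ^ Suc n"]) (auto simp: abs_mult 1)
  moreover have "\<forall>\<^sub>F N in sequentially.
      continuous_on UNIV (\<lambda>y. \<Sum>n<N. (1 / 2) ^ Suc n * dist (x n) (y n))"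
    by (intro always_eventually allI continuous_intros continuous_on_product_coordinates)
  ultimately have "continuous_on UNIV (\<lambda>y. \<Sum>n. (1 / 2) ^ Suc n * dist (x n) (y n))"
    by (intro uniform_limit_theorem) auto
  then show ?thesis
    by (simp add: dist_Omega_def[abs_def])
qed

lemma dist_component_le_dist_Omega:
  fixes x y :: "nat \<Rightarrow> 'a::metric_space"
  assumes "compact (UNIV :: 'a set)" "diameter (UNIV :: 'a set) = 1"
  shows "(1 / 2) ^ Suc n * dist (x n) (y n) \<le> dist_Omega x y"
  using sum_le_suminf[OF summable_dist_Omega[OF assms, of x y], of "{n}"]
  by (simp add: dist_Omega_def)

lemma open_iff_dist_Omega:
  fixes U :: "(nat \<Rightarrow> 'a::metric_space) set"
  assumes M: "compact (UNIV :: 'a set)" "diameter (UNIV :: 'a set) = 1"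
  shows "open U \<longleftrightarrow> (\<forall>x\<in>U. \<exists>e>0. \<forall>y. dist_Omega x y < e \<longrightarrow> y \<in> U)"
proof
  assume U: "open U"
  show "\<forall>x\<in>U. \<exists>e>0. \<forall>y. dist_Omega x y < e \<longrightarrow> y \<in> U"
  proof
    fix x assume "x \<in> U"
    then obtain X where X: "x \<in> Pi\<^sub>E UNIV X" "\<And>i. open (X i)" "finite {i. X i \<noteq> UNIV}"
        "Pi\<^sub>E UNIV X \<subseteq> U"
      using product_topology_open_contains_basis[of "\<lambda>_. euclidean" UNIV U x] U
      unfolding open_fun_def by auto
    have "\<exists>e>0. \<forall>z. dist (x i) z < e \<longrightarrow> z \<in> X i" for i
      using X(1,2) unfolding open_dist by (metis PiE_mem UNIV_I dist_commute)
    then obtain r where r: "\<And>i. r i > 0" "\<And>i z. dist (x i) z < r i \<Longrightarrow> z \<in> X i"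
      by metis
    define e where "e = Min (insert 1 ((\<lambda>i. (1 / 2) ^ Suc i * r i) ` {i. X i \<noteq> UNIV}))"
    have "e > 0"
      unfolding e_def using X(3) r(1) by (subst Min_gr_iff) auto
    moreover have "y \<in> U" if y: "dist_Omega x y < e" for y
    proof -
      have "y i \<in> X i" for i
      proof (cases "X i = UNIV")
        case False
        have "(1 / 2) ^ Suc i * dist (x i) (y i) < e"
          using dist_component_le_dist_Omega[OF M, of i x y] y by linarith
        also have "e \<le> (1 / 2) ^ Suc i * r i"
          unfolding e_def using X(3) False by (intro Min_le) auto
        finally show ?thesis
          by (intro r(2)) (simp add: field_simps)
      qed simp
      then show ?thesis
        using X(4) by auto
    qed
    ultimately show "\<exists>e>0. \<forall>y. dist_Omega x y < e \<longrightarrow> y \<in> U"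
      by blast
  qed
next
  assume *: "\<forall>x\<in>U. \<exists>e>0. \<forall>y. dist_Omega x y < e \<longrightarrow> y \<in> U"
  then obtain e where e: "\<And>x. x \<in> U \<Longrightarrow> e x > 0" "\<And>x y. x \<in> U \<Longrightarrow> dist_Omega x y < e x \<Longrightarrow> y \<in> U"
    by metis
  have "dist_Omega x x = 0" for x :: "nat \<Rightarrow> 'a"
    by (simp add: dist_Omega_def)
  then have "U \<subseteq> (\<Union>x\<in>U. dist_Omega x -` {..<e x})"
    using e(1) by (simp add: subset_iff) (metis)
  moreover have "(\<Union>x\<in>U. dist_Omega x -` {..<e x}) \<subseteq> U"
    using e(2) by blast
  ultimately have "U = (\<Union>x\<in>U. dist_Omega x -` {..<e x})"
    by (rule equalityI)
  then have "open U = open (\<Union>x\<in>U. dist_Omega x -` {..<e x})"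
    by (rule arg_cong)
  moreover have "open (dist_Omega x -` {..<e x})" for x
    using continuous_on_dist_Omega[OF M, of x] by (intro open_vimage) auto
  then have "open (\<Union>x\<in>U. dist_Omega x -` {..<e x})"
    by (intro open_UN ballI)
  ultimately show "open U"
    by (rule iffD2)
qed

lemma Lip_Omega_continuous:
  fixes f :: "(nat \<Rightarrow> 'a::metric_space) \<Rightarrow> real"
  assumes M: "compact (UNIV :: 'a set)" "diameter (UNIV :: 'a set) = 1" and f: "f \<in> Lip_Omega"
  shows "continuous_on UNIV f"
proof -
  obtain C where C: "\<And>x y. \<bar>f x - f y\<bar> \<le> C * dist_Omega x y"
    using f by (auto simp: Lip_Omega_def)
  have "isCont f x" for x
    unfolding continuous_at
  proof (rule Lim_null[THEN iffD2], rule Lim_null_comparison)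
    show "\<forall>\<^sub>F y in at x. norm (f y - f x) \<le> C * dist_Omega x y"
      using C[of x] by (auto simp: abs_minus_commute)
    have "dist_Omega x x = 0"
      by (simp add: dist_Omega_def)
    moreover have "isCont (dist_Omega x) x"
      using continuous_on_dist_Omega[OF M, of x] by (simp add: continuous_on_eq_continuous_at)
    ultimately show "((\<lambda>y. C * dist_Omega x y) \<longlongrightarrow> 0) (at x)"
      by (intro tendsto_mult_right_zero) (simp add: continuous_at)
  qed
  then show ?thesis
    by (simp add: continuous_at_imp_continuous_on)
qed

text \<open>The definite description in \<open>rpf_eigenvalue\<close> has at most one solution.\<close>

lemma rpf_eigenvalue_eq:
  fixes nu :: "'a::metric_space measure"
  assumes M: "compact (UNIV :: 'a set)" "diameter (UNIV :: 'a set) = 1"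
    and t: "rpf_triple nu f l w rho"
  shows "rpf_eigenvalue nu f = l"
  unfolding rpf_eigenvalue_def
proof (rule the_equality)
  show "\<exists>w rho. rpf_triple nu f l w rho"
    using t by blast
  fix l' assume "\<exists>w rho. rpf_triple nu f l' w rho"
  then obtain w' rho' where t': "rpf_triple nu f l' w' rho'"
    by blast
  have cont: "continuous_on UNIV w'"
    using t' by (intro Lip_Omega_continuous[OF M]) (auto simp: rpf_triple_def)
  have rho: "sets rho = sets borel" "prob_space rho"
    using t by (auto simp: rpf_triple_def dual_eigenmeasure_def borel_probability_def)
  interpret prob_space rho by (rule rho)
  have comp: "compact (UNIV :: (nat \<Rightarrow> 'a) set)"
  proof -
    have "compact_space (euclidean :: 'a topology)"
      using M(1) by (simp add: compact_space_def)
    then have "compact_space (product_topology (\<lambda>_::nat. euclidean :: 'a topology) UNIV)"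
      by (simp add: compact_space_product_topology)
    then show ?thesis
      by (simp add: compact_space_def euclidean_product_topology)
  qed
  obtain z where z: "\<And>y. w' z \<le> w' y"
    using continuous_attains_inf[OF comp _ cont] by auto
  obtain z' where z': "\<And>y. w' y \<le> w' z'"
    using continuous_attains_sup[OF comp _ cont] by auto
  have pos: "w' y > 0" for y
    using t' by (auto simp: rpf_triple_def)
  have "w' \<in> borel_measurable rho"
    using borel_measurable_continuous_onI[OF cont] measurable_cong_sets[OF rho(1) refl] by blast
  then have "integrable rho w'"
    using pos z' by (intro integrable_const_bound[where B = "w' z'"]) (auto simp: less_imp_le)
  then have "w' z \<le> (\<integral>x. w' x \<partial>rho)"
    using integral_mono[of rho "\<lambda>_. w' z" w'] z by (simp add: prob_space)
  then have "(\<integral>x. w' x \<partial>rho) > 0"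
    using pos[of z] by linarith
  moreover have "(\<integral>x. ruelle nu f w' x \<partial>rho) = l * (\<integral>x. w' x \<partial>rho)"
    using t cont by (auto simp: rpf_triple_def dual_eigenmeasure_def)
  moreover have "(\<integral>x. ruelle nu f w' x \<partial>rho) = l' * (\<integral>x. w' x \<partial>rho)"
    using t' by (simp add: rpf_triple_def)
  ultimately show "l' = l"
    by simp
qed

end

theory Submission
  imports Defs
begin

text \<open>
  Strict invariance of cones of log-Lipschitz functions under \<open>L = \<L>\<^sub>f\<close> shows that \<open>L\<^sup>n\<close> contracts
  Lipschitz functions modulo constants exponentially. Hence \<open>I - L\<close> is boundedly invertible on
  Lipschitz functions of mean zero, and an eigenpair of \<open>\<L>\<^bsub>f + t g\<^esub>\<close> can be expanded in \<open>t\<close> with an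
  error \<open>O(t\<^sup>2)\<close>, using nothing about its dependence on \<open>t\<close>. Since
  \<open>f\<^sub>s = f + s g + \<phi>\<^sub>s - \<phi>\<^sub>s \<circ> T - ln \<lambda>\<^sub>s\<close> is again normalized, with measure \<open>\<mu>\<^sub>s = w\<^sub>s \<rho>\<^sub>s\<close>, the
  expansion at \<open>f\<^sub>s\<close> gives \<open>p'(s) = \<integral>g d\<mu>\<^sub>s\<close> for every \<open>s\<close>. With \<open>g - \<integral>g d\<mu> = G - L G\<close> one has
  \<open>p'(t) - p'(0) = \<integral>L ((exp (f\<^sub>t - f) - 1) G) d\<mu>\<^sub>t\<close>, so \<open>p''(0) = \<integral>\<psi> G d\<mu>\<close> where
  \<open>\<psi> = G - (L G) \<circ> T\<close> is the derivative of \<open>f\<^sub>t\<close> at \<open>t = 0\<close>. Finally \<open>L \<psi> = 0\<close> makes \<open>\<psi>\<close> orthogonal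
  to \<open>(L G) \<circ> T\<close>, whence \<open>p''(0) = \<integral>\<psi>\<^sup>2 d\<mu>\<close>.
\<close>

section \<open>Elementary estimates\<close>

lemma exp_diff_le:
  fixes a b :: real
  assumes "b \<le> a" "a \<le> B"
  shows "exp a - exp b \<le> exp B * (a - b)"
proof -
  have "1 - (a - b) \<le> exp (b - a)"
    using exp_ge_add_one_self[of "b - a"] by linarith
  then have "exp a * (1 - exp (b - a)) \<le> exp a * (a - b)"
    by (intro mult_left_mono) auto
  also have "\<dots> \<le> exp B * (a - b)"
    using assms by (intro mult_right_mono) auto
  finally show ?thesis
    by (simp add: right_diff_distrib flip: exp_add)
qed

lemma abs_exp_diff_le:
  fixes a b :: real
  assumes "\<bar>a\<bar> \<le> B" "\<bar>b\<bar> \<le> B"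
  shows "\<bar>exp a - exp b\<bar> \<le> exp B * \<bar>a - b\<bar>"
proof (cases "b \<le> a")
  case True
  then show ?thesis
    using exp_diff_le[of b a B] assms by simp
next
  case False
  then show ?thesis
    using exp_diff_le[of a b B] assms by simp
qed

lemma abs_exp_minus_one_le:
  fixes a :: real
  assumes "\<bar>a\<bar> \<le> B"
  shows "\<bar>exp a - 1\<bar> \<le> B * exp B"
proof -
  have "\<bar>exp a - exp 0\<bar> \<le> exp B * \<bar>a - 0\<bar>"
    using assms by (intro abs_exp_diff_le) auto
  also have "\<dots> \<le> exp B * B"
    using assms by (intro mult_left_mono) auto
  finally show ?thesis by (simp add: mult_ac)
qed

text \<open>The derivative of the remainder at \<open>z\<close> is \<open>exp z - 1\<close>, itself
  of order \<open>B\<close>. This extra factor makes the error terms of the expansion quadratic in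
  \<open>t\<close> in the Lipschitz seminorm as well.\<close>

lemma exp_remainder_diff_le:
  fixes a b :: real
  assumes "\<bar>a\<bar> \<le> B" "\<bar>b\<bar> \<le> B" "b \<le> a"
  shows "\<bar>(exp a - 1 - a) - (exp b - 1 - b)\<bar> \<le> B * exp B * (a - b)"
proof (cases "a = b")
  case False
  then have "b < a" using assms by simp
  have "\<exists>z>b. z < a \<and> (exp a - 1 - a) - (exp b - 1 - b) = (a - b) * (exp z - 1)"
    by (rule MVT2[OF \<open>b < a\<close>]) (auto intro!: derivative_eq_intros)
  then obtain z where z: "b < z" "z < a" "(exp a - 1 - a) - (exp b - 1 - b) = (a - b) * (exp z - 1)"
    by blast
  have "\<bar>exp z - 1\<bar> \<le> B * exp B"
    using z assms by (intro abs_exp_minus_one_le) auto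
  then have "\<bar>(a - b) * (exp z - 1)\<bar> \<le> (a - b) * (B * exp B)"
    using assms by (auto simp: abs_mult intro!: mult_left_mono)
  then show ?thesis
    using z(3) by (simp add: mult_ac)
qed simp

lemma exp_remainder_diff_abs_le:
  fixes a b :: real
  assumes "\<bar>a\<bar> \<le> B" "\<bar>b\<bar> \<le> B"
  shows "\<bar>(exp a - 1 - a) - (exp b - 1 - b)\<bar> \<le> B * exp B * \<bar>a - b\<bar>"
  using exp_remainder_diff_le[of a B b] exp_remainder_diff_le[of b B a] assms
  by (cases "b \<le> a") (auto simp: abs_minus_commute)

lemma exp_remainder_le:
  fixes a :: real
  assumes "\<bar>a\<bar> \<le> B"
  shows "\<bar>exp a - 1 - a\<bar> \<le> B\<^sup>2 * exp B"
proof -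
  have "\<bar>exp a - 1 - a\<bar> \<le> B * exp B * \<bar>a\<bar>"
    using exp_remainder_diff_abs_le[of a B 0] assms by simp
  also have "\<dots> \<le> B * exp B * B"
    using assms by (intro mult_left_mono) auto
  finally show ?thesis by (simp add: power2_eq_square mult_ac)
qed

lemma exp_minus_mult_le_iff:
  fixes a b c :: real
  shows "exp (- b) * a \<le> c \<longleftrightarrow> a \<le> exp b * c"
  using mult_le_cancel_left_pos[of "exp b" "exp (- b) * a" c]
  by (simp flip: exp_add mult.assoc)

text \<open>All derivatives in \<open>t\<close> come from this criterion: differentiability follows
  from a quadratic error bound, with no regularity of \<open>F\<close> known in advance.\<close>

lemma has_derivative_quadratic_remainder:
  fixes F :: "real \<Rightarrow> real"
  assumes "\<And>t. \<bar>t\<bar> \<le> 1 \<Longrightarrow> \<bar>F (s + t) - F s - t * m\<bar> \<le> C * t\<^sup>2"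
  shows "(F has_real_derivative m) (at s)"
  unfolding DERIV_def
proof (rule LIM_zero_cancel, rule Lim_null_comparison)
  have "\<forall>\<^sub>F t in at (0::real). dist t 0 < 1" "\<forall>\<^sub>F t in at (0::real). t \<noteq> 0"
    by (auto simp: eventually_at intro: exI[of _ 1])
  then show "\<forall>\<^sub>F t in at 0. norm ((F (s + t) - F s) / t - m) \<le> C * \<bar>t\<bar>"
  proof eventually_elim
    case (elim t)
    have "\<bar>t\<bar> * \<bar>(F (s + t) - F s) / t - m\<bar> = \<bar>F (s + t) - F s - t * m\<bar>"
      using elim by (simp add: field_simps flip: abs_mult)
    also have "\<dots> \<le> \<bar>t\<bar> * (C * \<bar>t\<bar>)"
    proof -
      have "\<bar>t\<bar> * (C * \<bar>t\<bar>) = C * t\<^sup>2"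
        by (simp add: power2_eq_square mult.left_commute[of _ C])
      moreover have "\<bar>t\<bar> \<le> 1" using elim by simp
      ultimately show ?thesis using assms[of t] by (simp only:)
    qed
    finally show ?case
      using elim by simp
  qed
  show "((\<lambda>t. C * \<bar>t\<bar>) \<longlongrightarrow> 0) (at (0::real))"
    by (intro tendsto_mult_right_zero tendsto_rabs_zero tendsto_ident_at)
qed

section \<open>Lipschitz functions and the Ruelle operator\<close>

text \<open>\<open>Lip_Omega\<close> hides the constant, whereas contraction and errors of order
  \<open>t\<^sup>2\<close> are statements about constants.\<close>

definition lip :: "real \<Rightarrow> ((nat \<Rightarrow> 'a::metric_space) \<Rightarrow> real) \<Rightarrow> bool" where
  "lip A h \<longleftrightarrow> 0 \<le> A \<and> (\<forall>x y. \<bar>h x - h y\<bar> \<le> A * dist_Omega x y)"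

lemma lipD: "lip A h \<Longrightarrow> \<bar>h x - h y\<bar> \<le> A * dist_Omega x y"
  by (simp add: lip_def)

lemma lip_nonneg: "lip A h \<Longrightarrow> 0 \<le> A"
  by (simp add: lip_def)

lemma lip_imp_Lip_Omega: "lip A h \<Longrightarrow> h \<in> Lip_Omega"
  by (auto simp: lip_def Lip_Omega_def)

locale shift_space =
  fixes nu :: "'a::metric_space measure"
  assumes compact_M: "compact (UNIV :: 'a set)"
    and diameter_M: "diameter (UNIV :: 'a set) = 1"
    and prob_nu: "borel_probability nu"
begin

lemma dist_M_le_1: "dist (a :: 'a) b \<le> 1"
  using diameter_bounded_bound[OF compact_imp_bounded[OF compact_M], of a b] diameter_M by simp

lemma summable_dist: "summable (\<lambda>n. (1 / 2) ^ Suc n * dist (x n) (y n :: 'a))"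
  by (rule summable_dist_Omega[OF compact_M diameter_M])

lemma dist_Omega_nonneg: "0 \<le> dist_Omega x (y :: nat \<Rightarrow> 'a)"
  unfolding dist_Omega_def by (rule suminf_nonneg[OF summable_dist]) simp

lemma dist_Omega_commute: "dist_Omega x (y :: nat \<Rightarrow> 'a) = dist_Omega y x"
  by (simp add: dist_Omega_def dist_commute)

lemma dist_Omega_le_1: "dist_Omega x (y :: nat \<Rightarrow> 'a) \<le> 1"
proof -
  have "dist_Omega x y \<le> (\<Sum>n. (1 / 2 :: real) ^ Suc n)"
    unfolding dist_Omega_def
    by (rule suminf_le[OF _ summable_dist]) (auto simp: dist_M_le_1)
  also have "\<dots> = 1"
    using power_half_series by (rule sums_unique[symmetric])
  finally show ?thesis .
qed

text \<open>The weights halve from one coordinate to the next, so prepending a common symbol halves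
  distances, the source of all contraction, while the shift at most doubles them.\<close>

lemma dist_Omega_shift:
  "dist_Omega x (y :: nat \<Rightarrow> 'a) = dist (x 0) (y 0) / 2 + dist_Omega (shift x) (shift y) / 2"
proof -
  have "dist_Omega x y = (\<Sum>n. (1 / 2) ^ Suc (Suc n) * dist (x (Suc n)) (y (Suc n))) + dist (x 0) (y 0) / 2"
    unfolding dist_Omega_def using suminf_split_head[OF summable_dist[of x y]] by simp
  also have "(\<Sum>n. (1 / 2) ^ Suc (Suc n) * dist (x (Suc n)) (y (Suc n)))
      = (\<Sum>n. (1 / 2) * ((1 / 2) ^ Suc n * dist (shift x n) (shift y n)))"
    by (simp add: shift_def)
  also have "\<dots> = (1 / 2) * dist_Omega (shift x) (shift y)"
    unfolding dist_Omega_def by (rule suminf_mult[OF summable_dist])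
  finally show ?thesis by simp
qed

lemma shift_case_nat [simp]: "shift (case_nat a x) = x"
  by (simp add: shift_def)

lemma dist_Omega_case_nat:
  "dist_Omega (case_nat a x) (case_nat a (y :: nat \<Rightarrow> 'a)) = dist_Omega x y / 2"
  by (subst dist_Omega_shift) simp

lemma dist_Omega_shift_le: "dist_Omega (shift x) (shift (y :: nat \<Rightarrow> 'a)) \<le> 2 * dist_Omega x y"
  using dist_Omega_shift[of x y] by simp

lemma Lip_OmegaE:
  fixes h :: "(nat \<Rightarrow> 'a) \<Rightarrow> real"
  assumes "h \<in> Lip_Omega"
  obtains A where "lip A h"
proof -
  obtain C where C: "\<And>x y. \<bar>h x - h y\<bar> \<le> C * dist_Omega x y"
    using assms by (auto simp: Lip_Omega_def)
  have "\<bar>h x - h y\<bar> \<le> \<bar>C\<bar> * dist_Omega x y" for x y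
    using C[of x y] mult_right_mono[of C "\<bar>C\<bar>", OF _ dist_Omega_nonneg[of x y]] by linarith
  then show ?thesis
    by (intro that[of "\<bar>C\<bar>"]) (simp add: lip_def)
qed

lemma lipI:
  fixes h :: "(nat \<Rightarrow> 'a) \<Rightarrow> real"
  assumes "0 \<le> A" "\<And>x y. h x - h y \<le> A * dist_Omega x y"
  shows "lip A h"
  unfolding lip_def
proof (intro conjI allI)
  show "\<bar>h x - h y\<bar> \<le> A * dist_Omega x y" for x y
    using assms(2)[of x y] assms(2)[of y x] by (simp add: dist_Omega_commute abs_le_iff)
qed (rule assms)

text \<open>\<open>\<Omega>\<close> has diameter at most 1, so a Lipschitz constant also bounds the
  oscillation.\<close>

lemma lip_le:
  fixes h :: "(nat \<Rightarrow> 'a) \<Rightarrow> real"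
  assumes "lip A h"
  shows "\<bar>h x - h y\<bar> \<le> A"
  using lipD[OF assms, of x y] mult_left_mono[OF dist_Omega_le_1[of x y] lip_nonneg[OF assms]]
  by linarith

lemma lip_mono:
  fixes h :: "(nat \<Rightarrow> 'a) \<Rightarrow> real"
  assumes "lip A h" "A \<le> B"
  shows "lip B h"
proof (rule lipI)
  show "0 \<le> B" using assms lip_nonneg by force
  show "h x - h y \<le> B * dist_Omega x y" for x y
    using lipD[OF assms(1), of x y] mult_right_mono[OF assms(2) dist_Omega_nonneg[of x y]] by linarith
qed

lemma Lip_Omega_bounded:
  fixes h :: "(nat \<Rightarrow> 'a) \<Rightarrow> real"
  assumes "h \<in> Lip_Omega"
  obtains B where "0 \<le> B" "\<And>x. \<bar>h x\<bar> \<le> B"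
proof -
  obtain A where A: "lip A h"
    using assms by (rule Lip_OmegaE)
  have "\<bar>h x\<bar> \<le> \<bar>h undefined\<bar> + A" for x
    using lip_le[OF A, of x undefined] by linarith
  then show ?thesis
    using lip_nonneg[OF A] by (intro that[of "\<bar>h undefined\<bar> + A"]) auto
qed

lemma lip_const: "0 \<le> A \<Longrightarrow> lip A (\<lambda>_ :: nat \<Rightarrow> 'a. c)"
  by (rule lipI) (auto simp: dist_Omega_nonneg)

lemma lip_add:
  fixes h k :: "(nat \<Rightarrow> 'a) \<Rightarrow> real"
  assumes "lip A h" "lip B k"
  shows "lip (A + B) (\<lambda>x. h x + k x)"
proof (rule lipI)
  show "0 \<le> A + B"
    using lip_nonneg[OF assms(1)] lip_nonneg[OF assms(2)] by simp
  show "h x + k x - (h y + k y) \<le> (A + B) * dist_Omega x y" for x y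
    using lipD[OF assms(1), of x y] lipD[OF assms(2), of x y] by (simp add: distrib_right)
qed

lemma lip_cmult:
  fixes h :: "(nat \<Rightarrow> 'a) \<Rightarrow> real"
  assumes "lip A h"
  shows "lip (\<bar>c\<bar> * A) (\<lambda>x. c * h x)"
proof (rule lipI)
  show "0 \<le> \<bar>c\<bar> * A"
    using lip_nonneg[OF assms] by simp
  show "c * h x - c * h y \<le> \<bar>c\<bar> * A * dist_Omega x y" for x y
  proof -
    have "c * h x - c * h y \<le> \<bar>c\<bar> * \<bar>h x - h y\<bar>"
      by (metis abs_ge_self abs_mult right_diff_distrib)
    also have "\<dots> \<le> \<bar>c\<bar> * (A * dist_Omega x y)"
      by (intro mult_left_mono lipD[OF assms]) simp
    finally show ?thesis by simp
  qed
qed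

lemma lip_add_const:
  fixes h :: "(nat \<Rightarrow> 'a) \<Rightarrow> real"
  shows "lip A h \<Longrightarrow> lip A (\<lambda>x. h x + c)"
  using lip_add[of A h 0 "\<lambda>_. c"] lip_const[of 0 c] by simp

lemma lip_mult:
  fixes h k :: "(nat \<Rightarrow> 'a) \<Rightarrow> real"
  assumes h: "lip A h" "\<And>x. \<bar>h x\<bar> \<le> B" and k: "lip A' k" "\<And>x. \<bar>k x\<bar> \<le> B'"
  shows "lip (A * B' + B * A') (\<lambda>x. h x * k x)"
proof (rule lipI)
  have nn: "0 \<le> A" "0 \<le> A'" "0 \<le> B" "0 \<le> B'"
    using lip_nonneg[OF h(1)] lip_nonneg[OF k(1)] h(2)[of undefined] k(2)[of undefined] by auto
  then show "0 \<le> A * B' + B * A'"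
    by simp
  fix x y
  have "h x * k x - h y * k y = (h x - h y) * k x + h y * (k x - k y)"
    by (simp add: algebra_simps)
  also have "\<dots> \<le> \<bar>h x - h y\<bar> * \<bar>k x\<bar> + \<bar>h y\<bar> * \<bar>k x - k y\<bar>"
    by (metis abs_ge_self abs_mult add_mono)
  also have "\<dots> \<le> (A * dist_Omega x y) * B' + B * (A' * dist_Omega x y)"
    using nn dist_Omega_nonneg[of x y]
    by (intro add_mono mult_mono lipD h k) auto
  finally show "h x * k x - h y * k y \<le> (A * B' + B * A') * dist_Omega x y"
    by (simp add: algebra_simps)
qed

lemma lip_exp:
  fixes h :: "(nat \<Rightarrow> 'a) \<Rightarrow> real"
  assumes "lip A h" "\<And>x. \<bar>h x\<bar> \<le> B"
  shows "lip (A * exp B) (\<lambda>x. exp (h x))"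
proof (rule lipI)
  fix x y
  have "exp (h x) - exp (h y) \<le> exp B * \<bar>h x - h y\<bar>"
    using abs_exp_diff_le[OF assms(2)[of x] assms(2)[of y]] by linarith
  also have "\<dots> \<le> exp B * (A * dist_Omega x y)"
    by (intro mult_left_mono lipD assms) auto
  finally show "exp (h x) - exp (h y) \<le> A * exp B * dist_Omega x y"
    by (simp add: mult_ac)
qed (use lip_nonneg[OF assms(1)] in auto)

lemma lip_exp_remainder:
  fixes h :: "(nat \<Rightarrow> 'a) \<Rightarrow> real"
  assumes "lip A h" "\<And>x. \<bar>h x\<bar> \<le> B"
  shows "lip (A * B * exp B) (\<lambda>x. exp (h x) - 1 - h x)"
proof (rule lipI)
  have "0 \<le> B" using assms(2)[of undefined] by simp
  then show "0 \<le> A * B * exp B" using lip_nonneg[OF assms(1)] by simp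
  fix x y
  have "(exp (h x) - 1 - h x) - (exp (h y) - 1 - h y) \<le> B * exp B * \<bar>h x - h y\<bar>"
    using exp_remainder_diff_abs_le[OF assms(2)[of x] assms(2)[of y]] by linarith
  also have "\<dots> \<le> B * exp B * (A * dist_Omega x y)"
    using \<open>0 \<le> B\<close> by (intro mult_left_mono lipD assms) auto
  finally show "(exp (h x) - 1 - h x) - (exp (h y) - 1 - h y) \<le> A * B * exp B * dist_Omega x y"
    by (simp add: mult_ac)
qed

lemma lip_shift:
  fixes h :: "(nat \<Rightarrow> 'a) \<Rightarrow> real"
  assumes "lip A h"
  shows "lip (2 * A) (\<lambda>x. h (shift x))"
proof (rule lipI)
  show "h (shift x) - h (shift y) \<le> 2 * A * dist_Omega x y" for x y
    using lipD[OF assms, of "shift x" "shift y"]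
      mult_left_mono[OF dist_Omega_shift_le[of x y] lip_nonneg[OF assms]] by linarith
qed (use assms lip_nonneg in auto)

text \<open>By compactness \<open>exp (h x)\<close> has a positive minimum, above which the
  logarithm is Lipschitz. An RPF triple only says that the eigenfunction itself is
  Lipschitz.\<close>

lemma lip_log:
  fixes h :: "(nat \<Rightarrow> 'a) \<Rightarrow> real"
  assumes "(\<lambda>x. exp (h x)) \<in> Lip_Omega"
  shows "h \<in> Lip_Omega"
proof -
  have comp: "compact (UNIV :: (nat \<Rightarrow> 'a) set)"
  proof -
    have "compact_space (euclidean :: 'a topology)"
      using compact_M by (simp add: compact_space_def)
    then have "compact_space (product_topology (\<lambda>_::nat. euclidean :: 'a topology) UNIV)"
      by (simp add: compact_space_product_topology)
    then show ?thesis
      by (simp add: compact_space_def euclidean_product_topology)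
  qed
  obtain z where z: "\<And>y. exp (h z) \<le> exp (h y)"
    using continuous_attains_inf[OF comp _ Lip_Omega_continuous[OF compact_M diameter_M assms]] by auto
  obtain A where A: "lip A (\<lambda>x. exp (h x))"
    using assms by (rule Lip_OmegaE)
  have "lip (A * exp (- h z)) h"
  proof (rule lipI)
    show "h x - h y \<le> A * exp (- h z) * dist_Omega x y" for x y
    proof -
      have "h x - h y \<le> exp (h x - h y) - 1"
        using exp_ge_add_one_self[of "h x - h y"] by linarith
      also have "\<dots> = exp (- h y) * (exp (h x) - exp (h y))"
        by (simp add: right_diff_distrib flip: exp_add)
      also have "\<dots> \<le> exp (- h y) * (A * dist_Omega x y)"
        using lipD[OF A, of x y] by (intro mult_left_mono) auto
      also have "\<dots> \<le> exp (- h z) * (A * dist_Omega x y)"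
        using z[of y] lip_nonneg[OF A] dist_Omega_nonneg[of x y] by (intro mult_right_mono) auto
      finally show ?thesis by (simp add: mult_ac)
    qed
  qed (use lip_nonneg[OF A] in auto)
  then show ?thesis
    by (rule lip_imp_Lip_Omega)
qed

lemma Lip_const [simp]: "(\<lambda>_ :: nat \<Rightarrow> 'a. c) \<in> Lip_Omega"
  using lip_const[of 0 c] by (auto intro: lip_imp_Lip_Omega)

lemma Lip_add [intro]:
  fixes h k :: "(nat \<Rightarrow> 'a) \<Rightarrow> real"
  shows "h \<in> Lip_Omega \<Longrightarrow> k \<in> Lip_Omega \<Longrightarrow> (\<lambda>x. h x + k x) \<in> Lip_Omega"
  by (elim Lip_OmegaE) (rule lip_imp_Lip_Omega[OF lip_add])

lemma Lip_mult [intro]: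
  fixes h k :: "(nat \<Rightarrow> 'a) \<Rightarrow> real"
  shows "h \<in> Lip_Omega \<Longrightarrow> k \<in> Lip_Omega \<Longrightarrow> (\<lambda>x. h x * k x) \<in> Lip_Omega"
  by (metis Lip_OmegaE Lip_Omega_bounded lip_mult lip_imp_Lip_Omega)

lemma Lip_diff [intro]:
  fixes h k :: "(nat \<Rightarrow> 'a) \<Rightarrow> real"
  shows "h \<in> Lip_Omega \<Longrightarrow> k \<in> Lip_Omega \<Longrightarrow> (\<lambda>x. h x - k x) \<in> Lip_Omega"
  using Lip_add[of h "\<lambda>x. (- 1) * k x"] Lip_mult[of "\<lambda>_. - 1" k] by simp

lemma Lip_exp [intro]:
  fixes h :: "(nat \<Rightarrow> 'a) \<Rightarrow> real"
  shows "h \<in> Lip_Omega \<Longrightarrow> (\<lambda>x. exp (h x)) \<in> Lip_Omega"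
  by (metis Lip_OmegaE Lip_Omega_bounded lip_exp lip_imp_Lip_Omega)

lemma Lip_shift [intro]:
  fixes h :: "(nat \<Rightarrow> 'a) \<Rightarrow> real"
  shows "h \<in> Lip_Omega \<Longrightarrow> (\<lambda>x. h (shift x)) \<in> Lip_Omega"
  by (erule Lip_OmegaE) (rule lip_imp_Lip_Omega[OF lip_shift])

lemma Lip_integrable:
  fixes h :: "(nat \<Rightarrow> 'a) \<Rightarrow> real"
  assumes m: "borel_probability m" and h: "h \<in> Lip_Omega"
  shows "integrable m h"
proof -
  interpret prob_space m
    using m by (simp add: borel_probability_def)
  obtain B where "\<And>x. \<bar>h x\<bar> \<le> B"
    using Lip_Omega_bounded[OF h] by blast
  moreover have "h \<in> borel_measurable m"
    using borel_measurable_continuous_onI[OF Lip_Omega_continuous[OF compact_M diameter_M h]] m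
      measurable_cong_sets[of m borel borel borel] by (auto simp: borel_probability_def)
  ultimately show ?thesis
    by (intro integrable_const_bound[where B = B]) auto
qed

lemma continuous_case_nat: "continuous_on UNIV (\<lambda>a :: 'a. case_nat a x :: nat \<Rightarrow> 'a)"
proof (rule continuous_on_coordinatewise_then_product)
  show "continuous_on UNIV (\<lambda>a. case_nat a x i)" for i
    by (cases i) auto
qed

lemma Lip_integrable_nu:
  fixes h :: "(nat \<Rightarrow> 'a) \<Rightarrow> real"
  assumes h: "h \<in> Lip_Omega"
  shows "integrable nu (\<lambda>a. h (case_nat a x))"
proof -
  interpret prob_space nu
    using prob_nu by (simp add: borel_probability_def)
  obtain B where "\<And>x. \<bar>h x\<bar> \<le> B"
    using Lip_Omega_bounded[OF h] by blast
  moreover have "continuous_on UNIV (\<lambda>a. h (case_nat a x))"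
    using Lip_Omega_continuous[OF compact_M diameter_M h] continuous_case_nat
    by (rule continuous_on_compose2) auto
  then have "(\<lambda>a. h (case_nat a x)) \<in> borel_measurable nu"
    using borel_measurable_continuous_onI prob_nu
      measurable_cong_sets[of nu borel borel borel] by (auto simp: borel_probability_def)
  ultimately show ?thesis
    by (intro integrable_const_bound[where B = B]) auto
qed

context
  fixes F :: "(nat \<Rightarrow> 'a) \<Rightarrow> real"
  assumes F: "F \<in> Lip_Omega"
begin

lemma ruelle_integrable:
  "h \<in> Lip_Omega \<Longrightarrow> integrable nu (\<lambda>a. exp (F (case_nat a x)) * h (case_nat a x))"
  by (rule Lip_integrable_nu[OF Lip_mult[OF Lip_exp[OF F]]])

lemma ruelle_mono:
  assumes "h \<in> Lip_Omega" "k \<in> Lip_Omega" "\<And>x. h x \<le> k x"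
  shows "ruelle nu F h x \<le> ruelle nu F k x"
  unfolding ruelle_def using assms by (intro integral_mono ruelle_integrable mult_left_mono) auto

lemma ruelle_add:
  assumes "h \<in> Lip_Omega" "k \<in> Lip_Omega"
  shows "ruelle nu F (\<lambda>x. h x + k x) x = ruelle nu F h x + ruelle nu F k x"
  unfolding ruelle_def using assms by (simp add: distrib_left ruelle_integrable)

lemma ruelle_diff:
  assumes "h \<in> Lip_Omega" "k \<in> Lip_Omega"
  shows "ruelle nu F (\<lambda>x. h x - k x) x = ruelle nu F h x - ruelle nu F k x"
  unfolding ruelle_def using assms by (simp add: right_diff_distrib ruelle_integrable)

lemma ruelle_lip:
  assumes "lip A (\<lambda>x. exp (F x) * h x)"
  shows "lip A (ruelle nu F h)"
proof (rule lipI)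
  interpret prob_space nu
    using prob_nu by (simp add: borel_probability_def)
  let ?k = "\<lambda>x. exp (F x) * h x"
  have int: "integrable nu (\<lambda>a. ?k (case_nat a x))" for x
    by (rule Lip_integrable_nu[OF lip_imp_Lip_Omega[OF assms]])
  fix x y
  have "ruelle nu F h x \<le> (\<integral>a. ?k (case_nat a y) + A * dist_Omega x y \<partial>nu)"
    unfolding ruelle_def
  proof (intro integral_mono int Bochner_Integration.integrable_add integrable_const)
    fix a
    have "\<bar>?k (case_nat a x) - ?k (case_nat a y)\<bar> \<le> A * (dist_Omega x y / 2)"
      using lipD[OF assms, of "case_nat a x" "case_nat a y"] by (simp only: dist_Omega_case_nat)
    also have "\<dots> \<le> A * dist_Omega x y"
      using lip_nonneg[OF assms] dist_Omega_nonneg[of x y] by (intro mult_left_mono) auto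
    finally show "?k (case_nat a x) \<le> ?k (case_nat a y) + A * dist_Omega x y"
      by linarith
  qed
  also have "\<dots> = ruelle nu F h y + A * dist_Omega x y"
    using int[of y] by (simp add: ruelle_def prob_space)
  finally show "ruelle nu F h x - ruelle nu F h y \<le> A * dist_Omega x y"
    by simp
qed (use assms lip_nonneg in auto)

lemma ruelle_Lip [intro]: "h \<in> Lip_Omega \<Longrightarrow> ruelle nu F h \<in> Lip_Omega"
  by (metis Lip_OmegaE Lip_mult Lip_exp F ruelle_lip lip_imp_Lip_Omega)

end

lemma ruelle_cmult: "ruelle nu F (\<lambda>x. c * h x) x = c * ruelle nu F h x"
  unfolding ruelle_def by (simp add: mult.left_commute[of _ c])

text \<open>\<open>shift\<close> undoes prepending, so the first factor is constant on the points
  \<open>case_nat a x\<close> and leaves the integral.\<close>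

lemma ruelle_mult_shift: "ruelle nu F (\<lambda>x. h (shift x) * k x) x = h x * ruelle nu F k x"
  unfolding ruelle_def by (simp add: mult.left_commute[of _ "h x"])

end

section \<open>Cones and the spectral gap\<close>

text \<open>This is the cone of positive functions with \<open>K\<close>-Lipschitz logarithm. The
  multiplicative form is linear in \<open>h\<close> and hence survives integration.\<close>

definition logLip :: "real \<Rightarrow> ((nat \<Rightarrow> 'a::metric_space) \<Rightarrow> real) \<Rightarrow> bool" where
  "logLip K h \<longleftrightarrow> (\<forall>x. 0 < h x) \<and> (\<forall>x y. h x \<le> exp (K * dist_Omega x y) * h y)"

context shift_space
begin

text \<open>The weight contributes \<open>K\<close> and \<open>h\<close> contributes
  \<open>c\<close>, both over halved distances. For \<open>c = K + 2\<close> the result is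
  \<open>K + 1\<close>, the strict cone inclusion behind the spectral gap.\<close>

lemma ruelle_logLip:
  assumes F: "lip K F" and h: "h \<in> Lip_Omega" "logLip c h"
  shows "ruelle nu F h x \<le> exp ((K + c) / 2 * dist_Omega x y) * ruelle nu F h y"
proof -
  have FL: "F \<in> Lip_Omega"
    by (rule lip_imp_Lip_Omega[OF F])
  let ?k = "\<lambda>x. exp (F x) * h x"
  have int: "integrable nu (\<lambda>a. ?k (case_nat a x))" for x
    by (rule ruelle_integrable[OF FL h(1)])
  have "ruelle nu F h x \<le> (\<integral>a. exp ((K + c) / 2 * dist_Omega x y) * ?k (case_nat a y) \<partial>nu)"
    unfolding ruelle_def
  proof (intro integral_mono int integrable_mult_right)
    fix a
    let ?x = "case_nat a x" and ?y = "case_nat a y" and ?d = "dist_Omega x y / 2"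
    have "F ?x \<le> F ?y + K * ?d"
      using lipD[OF F, of ?x ?y] by (simp only: dist_Omega_case_nat)
    then have "exp (F ?x) \<le> exp (F ?y + K * ?d)"
      by simp
    moreover have "h ?x \<le> exp (c * ?d) * h ?y"
      using h(2) by (metis logLip_def dist_Omega_case_nat)
    ultimately have "?k ?x \<le> exp (F ?y + K * ?d) * (exp (c * ?d) * h ?y)"
      using h(2) by (intro mult_mono) (auto simp: logLip_def less_imp_le)
    also have "\<dots> = exp ((K + c) / 2 * dist_Omega x y) * ?k ?y"
      by (simp add: exp_add add_divide_distrib distrib_right)
    finally show "?k ?x \<le> exp ((K + c) / 2 * dist_Omega x y) * ?k ?y" .
  qed
  then show ?thesis
    by (simp add: ruelle_def)
qed

lemma logLip_exp:
  fixes h :: "(nat \<Rightarrow> 'a) \<Rightarrow> real"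
  assumes "lip K h"
  shows "logLip K (\<lambda>x. exp (h x))"
  unfolding logLip_def
proof (intro conjI allI)
  show "exp (h x) \<le> exp (K * dist_Omega x y) * exp (h y)" for x y
    using lipD[OF assms, of x y] by (simp flip: exp_add)
qed simp

text \<open>The a priori log-Lipschitz constant \<open>c\<close> of an eigenfunction improves to \<open>(K + c) / 2\<close>;
  iterating leaves \<open>K\<close>.\<close>

lemma log_eigenfunction_lip:
  assumes F: "lip K F" and h: "h \<in> Lip_Omega" and l: "l > 0"
    and eig: "\<And>x. ruelle nu F (\<lambda>x. exp (h x)) x = l * exp (h x)"
  shows "lip K h"
proof (rule lipI)
  show "0 \<le> K" by (rule lip_nonneg[OF F])
  obtain c where c: "lip c h" using h by (rule Lip_OmegaE)
  have step: "lip ((K + c) / 2) h" if "lip c h" for c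
  proof (rule lipI)
    show "0 \<le> (K + c) / 2" using lip_nonneg[OF F] lip_nonneg[OF that] by simp
    fix x y :: "nat \<Rightarrow> 'a"
    have "l * exp (h x) \<le> exp ((K + c) / 2 * dist_Omega x y) * (l * exp (h y))"
      using ruelle_logLip[OF F Lip_exp[OF h] logLip_exp[OF that], of x y] by (simp add: eig)
    then have "exp (h x) \<le> exp ((K + c) / 2 * dist_Omega x y + h y)"
      using l by (simp add: exp_add mult.left_commute[of _ l])
    then show "h x - h y \<le> (K + c) / 2 * dist_Omega x y" by simp
  qed
  have it: "lip (K + c / 2 ^ n) h" for n
  proof (induction n)
    case 0
    show ?case using lip_mono[OF c] lip_nonneg[OF F] by simp
  next
    case (Suc n)
    have "(K + (K + c / 2 ^ n)) / 2 = K + c / 2 ^ Suc n" by (simp add: field_simps)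
    then show ?case using step[OF Suc] by (simp only:)
  qed
  fix x y :: "nat \<Rightarrow> 'a"
  have "(\<lambda>n. (K + c * (1 / 2) ^ n) * dist_Omega x y) \<longlonglongrightarrow> (K + c * 0) * dist_Omega x y"
    by (intro tendsto_intros LIMSEQ_power_zero) auto
  moreover have "h x - h y \<le> (K + c * (1 / 2) ^ n) * dist_Omega x y" for n
    using abs_le_D1[OF lipD[OF it[of n], of x y]] by (simp add: power_one_over divide_simps)
  ultimately show "h x - h y \<le> K * dist_Omega x y"
    using LIMSEQ_le_const by fastforce
qed

end

text \<open>The locale serves both for \<open>f\<close> with \<open>mu\<close> and for each
  perturbed normalized potential with its own measure, so results at \<open>t = 0\<close> transfer
  to every base point. Invariance is tested on Lipschitz functions, the class in which all arguments
  stay.\<close>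

locale normalized_potential = shift_space nu for nu :: "'a::metric_space measure" +
  fixes f :: "(nat \<Rightarrow> 'a) \<Rightarrow> real" and mu :: "(nat \<Rightarrow> 'a) measure"
  assumes f_normalized: "f \<in> normalized_potentials nu"
    and prob_mu: "borel_probability mu"
    and integral_L: "h \<in> Lip_Omega \<Longrightarrow> (\<integral>x. ruelle nu f h x \<partial>mu) = (\<integral>x. h x \<partial>mu)"
begin

abbreviation L :: "((nat \<Rightarrow> 'a) \<Rightarrow> real) \<Rightarrow> (nat \<Rightarrow> 'a) \<Rightarrow> real" where
  "L \<equiv> ruelle nu f"

lemma f_Lip [intro]: "f \<in> Lip_Omega"
  using f_normalized by (simp add: normalized_potentials_def)

sublocale mu: prob_space mu
  using prob_mu by (simp add: borel_probability_def)

lemma L_const [simp]: "L (\<lambda>_. c) x = c"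
  using f_normalized ruelle_cmult[of f c "\<lambda>_. 1" x] by (simp add: normalized_potentials_def)

lemma L_Lip [intro]: "h \<in> Lip_Omega \<Longrightarrow> L h \<in> Lip_Omega"
  by (rule ruelle_Lip[OF f_Lip])

lemma mu_integrable [intro]: "h \<in> Lip_Omega \<Longrightarrow> integrable mu h"
  by (rule Lip_integrable[OF prob_mu])

declare mu.prob_space [simp]

lemma L_bound:
  assumes "h \<in> Lip_Omega" "\<And>x. \<bar>h x\<bar> \<le> B"
  shows "\<bar>L h x\<bar> \<le> B"
  using ruelle_mono[OF f_Lip assms(1) Lip_const[of B], of x]
    ruelle_mono[OF f_Lip Lip_const[of "- B"] assms(1), of x] assms(2)
  by (fastforce simp: abs_le_iff minus_le_iff)

lemma integral_bound:
  assumes "h \<in> Lip_Omega" "\<And>x. \<bar>h x\<bar> \<le> B"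
  shows "\<bar>\<integral>x. h x \<partial>mu\<bar> \<le> B"
  using integral_mono[OF mu_integrable[OF assms(1)] mu_integrable[OF Lip_const[of B]]]
    integral_mono[OF mu_integrable[OF Lip_const[of "- B"]] mu_integrable[OF assms(1)]] assms(2)
  by (fastforce simp: abs_le_iff minus_le_iff)

text \<open>All values of \<open>h\<close> stay within \<open>A\<close> of \<open>h x\<close>, hence
  so does their mean 0. This is how a Lipschitz constant controls a sup norm.\<close>

lemma mean_zero_bound:
  assumes "lip A h" "(\<integral>x. h x \<partial>mu) = 0"
  shows "\<bar>h x\<bar> \<le> A"
proof -
  have h: "h \<in> Lip_Omega" by (rule lip_imp_Lip_Omega[OF assms(1)])
  have "\<bar>\<integral>y. h y - h x \<partial>mu\<bar> \<le> A"
    using lip_le[OF assms(1)] by (intro integral_bound Lip_diff h) auto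
  then show ?thesis
    using assms(2) h by (simp add: mu_integrable)
qed

lemma L_pow_Lip [intro]: "h \<in> Lip_Omega \<Longrightarrow> (L ^^ n) h \<in> Lip_Omega"
  by (induction n) auto

lemma integral_L_pow: "h \<in> Lip_Omega \<Longrightarrow> (\<integral>x. (L ^^ n) h x \<partial>mu) = (\<integral>x. h x \<partial>mu)"
  by (induction n) (auto simp: integral_L[OF L_pow_Lip])

text \<open>Splitting off a multiple of the mean from a function in the smaller cone stays inside the
  larger cone; this is what turns \<open>L\<close>-invariance of cones into exponential contraction.\<close>

lemma cone_split:
  assumes K: "0 \<le> K" and h: "h \<in> Lip_Omega" "logLip (K + 1) h"
  defines "e \<equiv> exp (- (2 * K + 3)) / (K + 2)"
  shows "logLip (K + 2) (\<lambda>x. h x - e * (\<integral>x. h x \<partial>mu))"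
proof -
  define c where "c = (\<integral>x. h x \<partial>mu)"
  have pos: "0 < h x" for x using h(2) by (simp add: logLip_def)
  have e: "0 < e" using K by (simp add: e_def)
  \<comment> \<open>Distances are at most 1, so any two values of a function in this cone differ by
    a factor of at most \<open>exp (K + 1)\<close>, and the mean compares with each value in the
    same way.\<close>
  have c_le: "c \<le> exp (K + 1) * h y" for y
  proof -
    have "h x \<le> exp (K + 1) * h y" for x
    proof -
      have "h x \<le> exp ((K + 1) * dist_Omega x y) * h y"
        using h(2) by (simp add: logLip_def)
      also have "\<dots> \<le> exp (K + 1) * h y"
        using K pos[of y] dist_Omega_le_1[of x y]
        by (intro mult_right_mono) (auto simp: mult_left_le)
      finally show ?thesis .
    qed
    then show ?thesis
      unfolding c_def
      using integral_mono[OF mu_integrable[OF h(1)] mu_integrable[OF Lip_const[of "exp (K + 1) * h y"]]]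
      by simp
  qed
  \<comment> \<open>The exponent in \<open>e\<close> is
    \<open>2 * K + 3 = (K + 1) + (K + 2)\<close>: the first summand compensates \<open>c_le\<close>,
    the second, with the factor \<open>K + 2\<close>, the slope of \<open>exp ((K + 2) * d)\<close>
    for \<open>d\<close> in \<open>[0, 1]\<close>.\<close>
  have key: "e * c * (K + 2) * exp (K + 2) \<le> h y" for y
  proof -
    have "e * c * (K + 2) * exp (K + 2) = exp (- (K + 1)) * c"
      using K by (simp add: e_def field_simps flip: exp_add)
    also have "\<dots> \<le> exp (- (K + 1)) * (exp (K + 1) * h y)"
      by (intro mult_left_mono c_le) auto
    also have "\<dots> = h y"
      by (simp flip: exp_add mult.assoc)
    finally show ?thesis .
  qed
  have c0: "0 \<le> c"
    unfolding c_def using pos by (intro integral_nonneg_AE) (auto simp: less_imp_le)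
  show ?thesis
    unfolding c_def[symmetric] logLip_def
  proof (intro conjI allI)
    fix y
    have "e * c * 1 \<le> e * c * ((K + 2) * exp (K + 2) / 2)"
    proof (intro mult_left_mono)
      have "2 * 1 \<le> (K + 2) * exp (K + 2)"
        using K by (intro mult_mono) auto
      then show "1 \<le> (K + 2) * exp (K + 2) / 2" by simp
    qed (use e c0 in auto)
    also have "\<dots> \<le> h y / 2" using key[of y] by simp
    also have "\<dots> < h y" using pos[of y] by simp
    finally show "0 < h y - e * c" by simp
  next
    fix x y :: "nat \<Rightarrow> 'a"
    define d where "d = dist_Omega x y"
    have d: "0 \<le> d" "d \<le> 1" by (auto simp: d_def dist_Omega_nonneg dist_Omega_le_1)
    \<comment> \<open>Subtracting \<open>e * c\<close> costs
      \<open>e * c * (exp ((K + 2) * d) - 1)\<close>, at most \<open>d * h y\<close> by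
      \<open>key\<close>. The gap between the exponents \<open>K + 1\<close> and
      \<open>K + 2\<close> leaves at least \<open>d * h y\<close> to pay for it.\<close>
    have "exp ((K + 2) * d) - 1 \<le> (K + 2) * d * exp ((K + 2) * d)"
      using abs_exp_minus_one_le[of "(K + 2) * d" "(K + 2) * d"] K d by simp
    also have "\<dots> \<le> (K + 2) * d * exp (K + 2)"
      using K d by (intro mult_left_mono) (auto simp: mult_left_le)
    finally have "e * c * (exp ((K + 2) * d) - 1) \<le> e * c * ((K + 2) * d * exp (K + 2))"
      using e c0 by (intro mult_left_mono) auto
    also have "\<dots> = d * (e * c * (K + 2) * exp (K + 2))" by simp
    also have "\<dots> \<le> d * h y" by (intro mult_left_mono key d)
    also have "\<dots> \<le> (exp ((K + 2) * d) - exp ((K + 1) * d)) * h y"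
    proof (intro mult_right_mono less_imp_le[OF pos])
      have "d \<le> exp d - 1" using exp_ge_add_one_self[of d] by linarith
      also have "\<dots> \<le> exp ((K + 1) * d) * (exp d - 1)"
        using K d mult_right_mono[of 1 "exp ((K + 1) * d)" "exp d - 1"] by simp
      also have "\<dots> = exp ((K + 2) * d) - exp ((K + 1) * d)"
        by (simp add: algebra_simps flip: exp_add)
      finally show "d \<le> exp ((K + 2) * d) - exp ((K + 1) * d)" .
    qed
    finally have "e * c * (exp ((K + 2) * d) - 1) \<le> exp ((K + 2) * d) * h y - exp ((K + 1) * d) * h y"
      by (simp add: left_diff_distrib)
    moreover have "h x \<le> exp ((K + 1) * d) * h y"
      using h(2) by (simp add: logLip_def d_def)
    ultimately have "h x - e * c \<le> exp ((K + 2) * d) * (h y - e * c)"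
      by (simp add: algebra_simps)
    then show "h x - e * c \<le> exp ((K + 2) * dist_Omega x y) * (h y - e * c)"
      by (simp only: d_def)
  qed
qed

text \<open>Each application of \<open>L\<close> moves \<open>k\<close> from the cone of constant
  \<open>K + 2\<close> into that of constant \<open>K + 1\<close>, where \<open>cone_split\<close>
  can remove the fraction \<open>e\<close> of its mean. The non-constant part of the iterate thus
  sits in a cone element whose mean decays geometrically.\<close>

lemma cone_iterate:
  assumes K: "lip K f" and h: "h \<in> Lip_Omega" "logLip (K + 2) h"
  defines "e \<equiv> exp (- (2 * K + 3)) / (K + 2)"
  shows "\<exists>k. k \<in> Lip_Omega \<and> logLip (K + 2) k \<and> (\<integral>x. k x \<partial>mu) = (1 - e) ^ n * (\<integral>x. h x \<partial>mu) \<and>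
    (\<forall>x. (L ^^ n) h x = k x + (1 - (1 - e) ^ n) * (\<integral>x. h x \<partial>mu))"
proof (induction n)
  case 0
  show ?case using h by (intro exI[of _ h]) auto
next
  case (Suc n)
  define c where "c = (\<integral>x. h x \<partial>mu)"
  obtain k where k: "k \<in> Lip_Omega" "logLip (K + 2) k" "(\<integral>x. k x \<partial>mu) = (1 - e) ^ n * c"
    "\<And>x. (L ^^ n) h x = k x + (1 - (1 - e) ^ n) * c"
    using Suc by (auto simp: c_def)
  have K0: "0 \<le> K" by (rule lip_nonneg[OF K])
  have Lk: "L k \<in> Lip_Omega" using k(1) by blast
  \<comment> \<open>\<open>ruelle_mono\<close> gives weak inequalities only, so \<open>k\<close> is
    first bounded below by a positive constant, which \<open>L\<close> fixes.\<close>
  have pos: "0 < L k x" for x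
  proof -
    have "0 < k undefined" using k(2) by (simp add: logLip_def)
    have "exp (- (K + 2)) * k undefined \<le> k y" for y
    proof -
      have "k undefined \<le> exp ((K + 2) * dist_Omega undefined y) * k y"
        using k(2) by (simp add: logLip_def)
      also have "\<dots> \<le> exp (K + 2) * k y"
        using K0 k(2) dist_Omega_le_1[of undefined y]
        by (intro mult_right_mono) (auto simp: logLip_def mult_left_le less_imp_le)
      finally show ?thesis by (simp only: exp_minus_mult_le_iff)
    qed
    then have "L (\<lambda>_. exp (- (K + 2)) * k undefined) x \<le> L k x"
      by (intro ruelle_mono f_Lip k Lip_const)
    moreover have "0 < exp (- (K + 2)) * k undefined" using \<open>0 < k undefined\<close> by simp
    ultimately show ?thesis by simp
  qed
  have "(K + (K + 2)) / 2 = K + 1" by simp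
  then have "logLip (K + 1) (L k)"
    using pos ruelle_logLip[OF K k(1,2)] unfolding logLip_def by metis
  from cone_split[OF K0 Lk this]
  have "logLip (K + 2) (\<lambda>x. L k x - e * ((1 - e) ^ n * c))"
    by (simp add: e_def integral_L k)
  moreover have "(\<integral>x. L k x - e * ((1 - e) ^ n * c) \<partial>mu) = (1 - e) ^ Suc n * c"
    using Lk by (simp add: mu_integrable integral_L k algebra_simps)
  moreover have "(L ^^ Suc n) h x = L k x - e * ((1 - e) ^ n * c) + (1 - (1 - e) ^ Suc n) * c" for x
  proof -
    have "(L ^^ n) h = (\<lambda>x. k x + (1 - (1 - e) ^ n) * c)"
      by (rule ext) (rule k)
    then have "(L ^^ Suc n) h x = L (\<lambda>x. k x + (1 - (1 - e) ^ n) * c) x"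
      by simp
    also have "\<dots> = L k x + (1 - (1 - e) ^ n) * c"
      by (simp add: ruelle_add[OF f_Lip k(1) Lip_const])
    finally show ?thesis by (simp add: algebra_simps)
  qed
  ultimately show ?case
    unfolding c_def[symmetric] using Lk
    by (intro exI[of _ "\<lambda>x. L k x - e * ((1 - e) ^ n * c)"]) auto
qed

text \<open>Up to an additive constant \<open>h\<close> lies in the cone, so
  \<open>cone_iterate\<close> applies. In the cone the mean controls the sup norm, which in turn
  controls the Lipschitz constant, so the decay of the mean carries over.\<close>

lemma spectral_gap:
  obtains C \<theta> where "0 < C" "0 < \<theta>" "\<theta> < 1"
    "\<And>n A h. lip A h \<Longrightarrow> lip (C * \<theta> ^ n * A) ((L ^^ n) h)"
proof -
  obtain K where K: "lip K f" using f_Lip by (rule Lip_OmegaE)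
  have K0: "0 \<le> K" by (rule lip_nonneg[OF K])
  define e where "e = exp (- (2 * K + 3)) / (K + 2)"
  \<comment> \<open>\<open>(K + 2) * exp (K + 2)\<close> bounds the slope of
    \<open>exp ((K + 2) * d)\<close>, the other \<open>exp (K + 2)\<close> compares \<open>k\<close>
    with its mean, and 3 comes from the bound \<open>3 * A\<close> on \<open>h'\<close>.\<close>
  define C where "C = 3 * (K + 2) * (exp (K + 2) * exp (K + 2))"
  have e: "0 < e" "e < 1"
  proof -
    show "0 < e" using K0 by (simp add: e_def)
    have "exp (- (2 * K + 3)) < 1" using K0 by simp
    also have "1 < K + 2" using K0 by simp
    finally show "e < 1" using K0 by (simp add: e_def)
  qed
  have C: "0 < C" using K0 by (simp add: C_def)
  have main: "lip (C * (1 - e) ^ n * A) ((L ^^ n) h)" if h: "lip A h" and A: "0 < A" for n A h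
  proof -
    \<comment> \<open>\<open>h x - h undefined\<close> lies in \<open>[- A, A]\<close>, so adding
      \<open>2 * A\<close> moves it into \<open>[A, 3 * A]\<close>; the lower bound \<open>A\<close>
      makes an \<open>A\<close>-Lipschitz function log-Lipschitz with constant 1.
      \<open>undefined\<close> is an arbitrary base point.\<close>
    define a where "a = 2 * A - h undefined"
    define h' where "h' = (\<lambda>x. h x + a)"
    have hL: "h \<in> Lip_Omega" by (rule lip_imp_Lip_Omega[OF h])
    have h'L: "h' \<in> Lip_Omega" unfolding h'_def by (intro Lip_add hL Lip_const)
    have h'b: "A \<le> h' x" "h' x \<le> 3 * A" for x
      using lip_le[OF h, of x undefined] by (auto simp: h'_def a_def)
    have "logLip (K + 2) h'"
      unfolding logLip_def
    proof (intro conjI allI)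
      show "0 < h' x" for x using h'b(1)[of x] A by linarith
      fix x y :: "nat \<Rightarrow> 'a"
      have "h' x \<le> h' y + A * dist_Omega x y"
        using lipD[OF h, of x y] by (simp add: h'_def)
      also have "\<dots> \<le> h' y + h' y * dist_Omega x y"
        using h'b(1)[of y] dist_Omega_nonneg[of x y] by (intro add_left_mono mult_right_mono)
      also have "\<dots> = (1 + dist_Omega x y) * h' y" by (simp add: algebra_simps)
      also have "\<dots> \<le> exp (dist_Omega x y) * h' y"
        using h'b(1)[of y] A by (intro mult_right_mono exp_ge_add_one_self) auto
      also have "\<dots> \<le> exp ((K + 2) * dist_Omega x y) * h' y"
        using h'b(1)[of y] A K0 dist_Omega_nonneg[of x y]
        by (intro mult_right_mono) (auto simp: algebra_simps)
      finally show "h' x \<le> exp ((K + 2) * dist_Omega x y) * h' y" .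
    qed
    from cone_iterate[OF K h'L this, of n, folded e_def]
    obtain k where k: "k \<in> Lip_Omega" "logLip (K + 2) k" "(\<integral>x. k x \<partial>mu) = (1 - e) ^ n * (\<integral>x. h' x \<partial>mu)"
      "\<And>x. (L ^^ n) h' x = k x + (1 - (1 - e) ^ n) * (\<integral>x. h' x \<partial>mu)"
      by blast
    have shift: "(L ^^ n) h' x = (L ^^ n) h x + a" for x
    proof (induction n arbitrary: x)
      case (Suc n)
      then have "(L ^^ n) h' = (\<lambda>x. (L ^^ n) h x + a)" by blast
      then show ?case using L_pow_Lip[OF hL, of n] by (simp add: ruelle_add[OF f_Lip])
    qed (simp add: h'_def)
    have ih': "(\<integral>x. h' x \<partial>mu) \<le> 3 * A"
      using integral_mono[OF mu_integrable[OF h'L] mu_integrable[OF Lip_const[of "3 * A"]]] h'b(2) by simp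
    have kpos: "0 < k x" for x using k(2) by (simp add: logLip_def)
    have kb: "k y \<le> exp (K + 2) * ((1 - e) ^ n * (3 * A))" for y
    proof -
      have "exp (- (K + 2)) * k y \<le> k x" for x
      proof -
        have "k y \<le> exp ((K + 2) * dist_Omega y x) * k x"
          using k(2) by (simp add: logLip_def)
        also have "\<dots> \<le> exp (K + 2) * k x"
          using K0 kpos[of x] dist_Omega_le_1[of y x]
          by (intro mult_right_mono) (auto simp: mult_left_le less_imp_le)
        finally show ?thesis by (simp only: exp_minus_mult_le_iff)
      qed
      then have "exp (- (K + 2)) * k y \<le> (\<integral>x. k x \<partial>mu)"
        using integral_mono[OF mu_integrable[OF Lip_const[of "exp (- (K + 2)) * k y"]] mu_integrable[OF k(1)]]
        by simp
      also have "\<dots> \<le> (1 - e) ^ n * (3 * A)"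
        unfolding k(3) using e ih' by (intro mult_left_mono) auto
      finally show ?thesis by (simp only: exp_minus_mult_le_iff)
    qed
    show ?thesis
    proof (rule lipI)
      show "0 \<le> C * (1 - e) ^ n * A" using C e A by simp
      fix x y :: "nat \<Rightarrow> 'a"
      define d where "d = dist_Omega x y"
      have d: "0 \<le> d" "d \<le> 1" by (auto simp: d_def dist_Omega_nonneg dist_Omega_le_1)
      have "(L ^^ n) h x - (L ^^ n) h y = k x - k y"
        using k(4)[of x] k(4)[of y] by (simp add: shift)
      also have "\<dots> \<le> (exp ((K + 2) * d) - 1) * k y"
        using k(2) by (simp add: logLip_def d_def left_diff_distrib)
      also have "\<dots> \<le> ((K + 2) * d * exp (K + 2)) * (exp (K + 2) * ((1 - e) ^ n * (3 * A)))"
      proof (intro mult_mono kb)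
        have "exp ((K + 2) * d) - 1 \<le> (K + 2) * d * exp ((K + 2) * d)"
          using abs_exp_minus_one_le[of "(K + 2) * d" "(K + 2) * d"] K0 d by simp
        also have "\<dots> \<le> (K + 2) * d * exp (K + 2)"
          using K0 d by (intro mult_left_mono) (auto simp: mult_left_le)
        finally show "exp ((K + 2) * d) - 1 \<le> (K + 2) * d * exp (K + 2)" .
      qed (use K0 d kpos[of y] in auto)
      also have "\<dots> = C * (1 - e) ^ n * A * dist_Omega x y"
        by (simp only: C_def d_def mult_ac)
      finally show "(L ^^ n) h x - (L ^^ n) h y \<le> C * (1 - e) ^ n * A * dist_Omega x y" .
    qed
  qed
  have "lip (C * (1 - e) ^ n * A) ((L ^^ n) h)" if h: "lip A h" for n A h
  \<comment> \<open>For \<open>A = 0\<close> the translate used above is not positive, but then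
    \<open>h\<close> is constant and fixed by \<open>L\<close>.\<close>
  proof (cases "A = 0")
    case True
    have "h = (\<lambda>_. h undefined)"
      using lip_le[OF h] True by force
    moreover have "(L ^^ n) (\<lambda>_. h undefined) = (\<lambda>_. h undefined)"
      by (induction n) auto
    ultimately have "(L ^^ n) h = (\<lambda>_. h undefined)" by metis
    then show ?thesis using True by (simp add: lip_const)
  next
    case False
    then show ?thesis using main[OF h] lip_nonneg[OF h] by simp
  qed
  then show ?thesis
    using that[of C "1 - e"] C e by simp
qed

text \<open>Iterating the equation gives
  \<open>z = (L ^^ N) z + (\<Sum>n<N. (L ^^ Suc n) q)\<close>. The unknown Lipschitz constant of
  \<open>z\<close> drops out as \<open>N\<close> grows and the sum is dominated by a geometric
  series. The bound is therefore uniform in \<open>z\<close>, as needed for eigenfunctions whose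
  dependence on \<open>t\<close> is unknown.\<close>

lemma lip_of_coboundary:
  obtains C where "0 < C"
    "\<And>z q A. z \<in> Lip_Omega \<Longrightarrow> lip A q \<Longrightarrow> (\<And>x. z x - L z x = L q x) \<Longrightarrow> lip (C * A) z"
proof -
  obtain C \<theta> where C: "0 < C" and \<theta>: "0 < \<theta>" "\<theta> < 1"
    and gap: "\<And>n A h. lip A h \<Longrightarrow> lip (C * \<theta> ^ n * A) ((L ^^ n) h)"
    using spectral_gap by blast
  define D where "D = C / (1 - \<theta>)"
  have "lip (D * A) z" if z: "z \<in> Lip_Omega" and q: "lip A q" and eq: "\<And>x. z x - L z x = L q x" for z q A
  proof (rule lipI)
    have A: "0 \<le> A" by (rule lip_nonneg[OF q])
    then show "0 \<le> D * A" using C \<theta> by (simp add: D_def)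
    have qL: "q \<in> Lip_Omega" by (rule lip_imp_Lip_Omega[OF q])
    obtain B where B: "lip B z" using z by (rule Lip_OmegaE)
    have pw: "(L ^^ n) z x - (L ^^ Suc n) z x = (L ^^ Suc n) q x" for n x
    proof (induction n arbitrary: x)
      case (Suc n)
      have "(L ^^ Suc n) q = (\<lambda>x. (L ^^ n) z x - (L ^^ Suc n) z x)"
        using Suc by simp
      then have "(L ^^ Suc (Suc n)) q x = L (\<lambda>x. (L ^^ n) z x - (L ^^ Suc n) z x) x"
        by simp
      also have "\<dots> = (L ^^ Suc n) z x - (L ^^ Suc (Suc n)) z x"
        using ruelle_diff[OF f_Lip L_pow_Lip[OF z, of n] L_pow_Lip[OF z, of "Suc n"], of x] by simp
      finally show ?case by simp
    qed (simp add: eq)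
    have tele: "z x = (L ^^ N) z x + (\<Sum>n<N. (L ^^ Suc n) q x)" for N x
    proof (induction N)
      case (Suc N)
      then show ?case using pw[of N x] by simp
    qed simp
    fix x y :: "nat \<Rightarrow> 'a"
    let ?d = "dist_Omega x y"
    have "z x - z y \<le> C * \<theta> ^ N * B * ?d + D * A * ?d" for N
    proof -
      have "z x - z y = ((L ^^ N) z x - (L ^^ N) z y) + (\<Sum>n<N. (L ^^ Suc n) q x - (L ^^ Suc n) q y)"
        using tele[of x N] tele[of y N] by (simp add: sum_subtractf)
      also have "\<dots> \<le> C * \<theta> ^ N * B * ?d + (\<Sum>n<N. C * A * ?d * \<theta> ^ n)"
      proof (intro add_mono sum_mono)
        show "(L ^^ N) z x - (L ^^ N) z y \<le> C * \<theta> ^ N * B * ?d"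
          by (rule abs_le_D1[OF lipD[OF gap[OF B]]])
        fix n
        have "(L ^^ Suc n) q x - (L ^^ Suc n) q y \<le> C * \<theta> ^ Suc n * A * ?d"
          by (rule abs_le_D1[OF lipD[OF gap[OF q]]])
        also have "\<dots> = \<theta> * (C * A * ?d * \<theta> ^ n)" by simp
        also have "\<dots> \<le> 1 * (C * A * ?d * \<theta> ^ n)"
          using C \<theta> A dist_Omega_nonneg[of x y] by (intro mult_right_mono) auto
        finally show "(L ^^ Suc n) q x - (L ^^ Suc n) q y \<le> C * A * ?d * \<theta> ^ n" by simp
      qed
      also have "(\<Sum>n<N. C * A * ?d * \<theta> ^ n) = C * A * ?d * (\<Sum>n<N. \<theta> ^ n)"
        by (simp add: sum_distrib_left)
      also have "\<dots> \<le> C * A * ?d * (1 / (1 - \<theta>))"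
      proof (intro mult_left_mono)
        show "(\<Sum>n<N. \<theta> ^ n) \<le> 1 / (1 - \<theta>)"
          using \<theta> sum_le_suminf[of "\<lambda>n. \<theta> ^ n" "{..<N}"] suminf_geometric[of \<theta>]
          by (simp add: summable_geometric)
      qed (use C A dist_Omega_nonneg[of x y] in auto)
      finally show ?thesis by (simp add: D_def)
    qed
    moreover have "(\<lambda>N. C * \<theta> ^ N * B * ?d + D * A * ?d) \<longlonglongrightarrow> C * 0 * B * ?d + D * A * ?d"
      using \<theta> by (intro tendsto_intros LIMSEQ_power_zero) auto
    ultimately show "z x - z y \<le> D * A * ?d"
      using LIMSEQ_le_const by fastforce
  qed
  moreover have "0 < D" using C \<theta> by (simp add: D_def)
  ultimately show ?thesis using that by blast
qed

text \<open>The solution is the Neumann series of \<open>h\<close> minus its mean. The iterates keep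
  mean zero, so \<open>mean_zero_bound\<close> turns the decay of their Lipschitz constants into
  uniform convergence.\<close>

lemma poisson_equation:
  assumes h: "h \<in> Lip_Omega"
  obtains H where "H \<in> Lip_Omega" "\<And>x. H x - L H x = h x - (\<integral>y. h y \<partial>mu)"
    "(\<integral>x. H x \<partial>mu) = 0"
proof -
  obtain C \<theta> where C: "0 < C" and \<theta>: "0 < \<theta>" "\<theta> < 1"
    and gap: "\<And>n A h. lip A h \<Longrightarrow> lip (C * \<theta> ^ n * A) ((L ^^ n) h)"
    using spectral_gap by blast
  define q where "q = (\<lambda>x. h x - (\<integral>y. h y \<partial>mu))"
  have qL: "q \<in> Lip_Omega" unfolding q_def by (intro Lip_diff h Lip_const)
  have q0: "(\<integral>x. q x \<partial>mu) = 0" using h by (simp add: q_def mu_integrable)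
  obtain A where A: "lip A q" using qL by (rule Lip_OmegaE)
  have A0: "0 \<le> A" by (rule lip_nonneg[OF A])
  have bound: "\<bar>(L ^^ n) q x\<bar> \<le> C * A * \<theta> ^ n" for n x
    using mean_zero_bound[OF gap[OF A, of n], of x] by (simp add: integral_L_pow[OF qL] q0 mult_ac)
  have sg: "summable (\<lambda>n. C * A * \<theta> ^ n)"
    using \<theta> by (intro summable_mult summable_geometric) auto
  have sm: "summable (\<lambda>n. (L ^^ n) q x)" for x
    by (rule summable_comparison_test'[OF sg]) (use bound in auto)
  define H where "H = (\<lambda>x. \<Sum>n. (L ^^ n) q x)"
  define S where "S = (\<lambda>N x. \<Sum>n<N. (L ^^ n) q x)"
  have SL: "S N \<in> Lip_Omega" for N
  proof (induction N)
    case (Suc N)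
    then show ?case using Lip_add[OF Suc L_pow_Lip[OF qL, of N]] by (simp add: S_def)
  qed (simp add: S_def)
  have Slim: "(\<lambda>N. S N x) \<longlonglongrightarrow> H x" for x
    using summable_LIMSEQ[OF sm] by (simp add: S_def H_def)
  have HL: "H \<in> Lip_Omega"
  proof (rule lip_imp_Lip_Omega, rule lipI)
    show "0 \<le> C * A / (1 - \<theta>)" using C A0 \<theta> by simp
    fix x y :: "nat \<Rightarrow> 'a"
    have "H x - H y = (\<Sum>n. (L ^^ n) q x - (L ^^ n) q y)"
      unfolding H_def by (rule suminf_diff[OF sm sm])
    also have "\<dots> \<le> (\<Sum>n. C * A * dist_Omega x y * \<theta> ^ n)"
    proof (rule suminf_le)
      show "(L ^^ n) q x - (L ^^ n) q y \<le> C * A * dist_Omega x y * \<theta> ^ n" for n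
        using abs_le_D1[OF lipD[OF gap[OF A, of n], of x y]] by (simp add: mult_ac)
      show "summable (\<lambda>n. C * A * dist_Omega x y * \<theta> ^ n)"
        using \<theta> by (intro summable_mult summable_geometric) auto
    qed (intro summable_diff sm)
    also have "\<dots> = C * A / (1 - \<theta>) * dist_Omega x y"
      using \<theta> by (subst suminf_mult) (auto simp: summable_geometric suminf_geometric)
    finally show "H x - H y \<le> C * A / (1 - \<theta>) * dist_Omega x y" .
  qed
  \<comment> \<open>The bound is uniform in \<open>x\<close>, so \<open>L\<close> and the integral
    pass to the limit by their sup-norm bounds.\<close>
  have tail: "\<bar>H x - S N x\<bar> \<le> C * A / (1 - \<theta>) * \<theta> ^ N" for N x
  proof -
    have "H x - S N x = (\<Sum>n. (L ^^ (n + N)) q x)"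
      unfolding H_def S_def using suminf_split_initial_segment[OF sm[of x], of N] by simp
    also have "\<bar>\<dots>\<bar> \<le> (\<Sum>n. C * A * \<theta> ^ N * \<theta> ^ n)"
    proof (rule norm_suminf_le[where 'a = real, unfolded real_norm_def])
      show "summable (\<lambda>n. C * A * \<theta> ^ N * \<theta> ^ n)"
        using \<theta> by (intro summable_mult summable_geometric) auto
      show "\<bar>(L ^^ (n + N)) q x\<bar> \<le> C * A * \<theta> ^ N * \<theta> ^ n" for n
        using bound[of "n + N" x] by (simp add: power_add mult_ac)
    qed
    also have "\<dots> = C * A / (1 - \<theta>) * \<theta> ^ N"
      using \<theta> by (subst suminf_mult) (auto simp: summable_geometric suminf_geometric)
    finally show ?thesis .
  qed
  have tail0: "(\<lambda>N. C * A / (1 - \<theta>) * \<theta> ^ N) \<longlonglongrightarrow> 0"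
    using \<theta> by (intro tendsto_mult_right_zero LIMSEQ_power_zero) auto
  have LS: "L (S N) x = S (Suc N) x - q x" for N x
  proof (induction N)
    case (Suc N)
    have "L (S (Suc N)) x = L (\<lambda>x. S N x + (L ^^ N) q x) x"
      by (simp add: S_def)
    also have "\<dots> = L (S N) x + (L ^^ Suc N) q x"
      by (simp add: ruelle_add[OF f_Lip SL L_pow_Lip[OF qL]])
    finally show ?case using Suc by (simp add: S_def)
  qed (simp add: S_def)
  have LH: "L H x = H x - q x" for x
  proof (rule LIMSEQ_unique)
    show "(\<lambda>N. L (S N) x) \<longlonglongrightarrow> H x - q x"
      unfolding LS using LIMSEQ_Suc[OF Slim[of x]] by (intro tendsto_diff tendsto_const)
    have "(\<lambda>N. L (S N) x - L H x) \<longlonglongrightarrow> 0"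
    proof (rule Lim_null_comparison[OF always_eventually tail0], rule allI)
      fix N
      have "\<bar>L (\<lambda>x. S N x - H x) x\<bar> \<le> C * A / (1 - \<theta>) * \<theta> ^ N"
        using tail by (intro L_bound Lip_diff SL HL) (auto simp: abs_minus_commute)
      then show "norm (L (S N) x - L H x) \<le> C * A / (1 - \<theta>) * \<theta> ^ N"
        by (simp add: ruelle_diff[OF f_Lip SL HL])
    qed
    then show "(\<lambda>N. L (S N) x) \<longlonglongrightarrow> L H x"
      by (rule LIM_zero_cancel)
  qed
  have HLm: "(\<integral>x. H x \<partial>mu) = 0"
  proof -
    have S0: "(\<integral>x. S N x \<partial>mu) = 0" for N
      by (simp add: S_def mu_integrable[OF L_pow_Lip[OF qL]] integral_L_pow[OF qL] q0)
    have "\<bar>\<integral>x. H x \<partial>mu\<bar> \<le> C * A / (1 - \<theta>) * \<theta> ^ N" for N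
    proof -
      have "\<bar>\<integral>x. H x - S N x \<partial>mu\<bar> \<le> C * A / (1 - \<theta>) * \<theta> ^ N"
        using tail by (intro integral_bound Lip_diff SL HL) auto
      then show ?thesis by (simp add: mu_integrable SL HL S0)
    qed
    then have "\<bar>\<integral>x. H x \<partial>mu\<bar> \<le> 0"
      using LIMSEQ_le_const[OF tail0] by blast
    then show ?thesis by simp
  qed
  show ?thesis
    using that[OF HL _ HLm] LH by (simp add: q_def)
qed

section \<open>Perturbation of eigenpairs\<close>

text \<open>With \<open>u\<close> the eigenfunction normalized by \<open>\<integral>u d\<mu> = 1\<close>, \<open>k = t g - ln l\<close> and
  \<open>q = (e\<^sup>k - 1) u\<close>, the eigenvalue equation reads \<open>(I - L) (u - 1) = L q\<close>. Inverting \<open>I - L\<close> once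
  gives \<open>u = 1 + O(t)\<close>, and inverting it again on \<open>q - t (g - \<integral>g d\<mu>)\<close>, which is \<open>O(t\<^sup>2)\<close>
  modulo constants, gives the expansion to first order.\<close>

lemma eigenpair_expansion:
  assumes g: "g \<in> Lip_Omega" and G: "G \<in> Lip_Omega" "\<And>x. G x - L G x = g x - (\<integral>y. g y \<partial>mu)"
    "(\<integral>x. G x \<partial>mu) = 0"
  shows "\<exists>C. \<forall>t l h x. \<bar>t\<bar> \<le> 1 \<longrightarrow> 0 < l \<longrightarrow> h \<in> Lip_Omega \<longrightarrow>
      (\<forall>x. ruelle nu (\<lambda>x. f x + t * g x) (\<lambda>x. exp (h x)) x = l * exp (h x)) \<longrightarrow>
      \<bar>ln l - t * (\<integral>y. g y \<partial>mu)\<bar> \<le> C * t\<^sup>2 \<and>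
      \<bar>h x - h (shift x) - t * (L G x - L G (shift x))\<bar> \<le> C * t\<^sup>2"
proof -
  obtain Kf where Kf: "lip Kf f" using f_Lip by (rule Lip_OmegaE)
  obtain Kg where Kg: "lip Kg g" using g by (rule Lip_OmegaE)
  obtain B where B: "0 \<le> B" "\<And>x. \<bar>g x\<bar> \<le> B" using Lip_Omega_bounded[OF g] by blast
  obtain D where D: "0 < D"
    "\<And>z q A. z \<in> Lip_Omega \<Longrightarrow> lip A q \<Longrightarrow> (\<And>x. z x - L z x = L q x) \<Longrightarrow> lip (D * A) z"
    using lip_of_coboundary by blast
  have nn: "0 \<le> Kf" "0 \<le> Kg" using lip_nonneg[OF Kf] lip_nonneg[OF Kg] by auto
  define m where "m = (\<integral>y. g y \<partial>mu)"
  \<comment> \<open>\<open>K\<close> is a Lipschitz constant of \<open>f + t g\<close> for all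
    \<open>\<bar>t\<bar> \<le> 1\<close>, and \<open>E\<close> bounds \<open>exp (k x)\<close>.
    Relative to \<open>\<bar>t\<bar>\<close>, \<open>c1\<close> and \<open>c2\<close> are Lipschitz
    constants of \<open>q\<close> and \<open>u - 1\<close>; relative to \<open>t\<^sup>2\<close>,
    \<open>c3\<close> and \<open>c4\<close> bound the Lipschitz constant and the size of the
    second-order part \<open>r\<close>.\<close>
  define K where "K = Kf + Kg"
  define E where "E = exp (2 * B)"
  define c1 where "c1 = Kg * E * exp K + 2 * B * E * (K * exp K)"
  define c2 where "c2 = D * c1"
  define c3 where "c3 = Kg * (2 * B) * E * exp K + (2 * B)\<^sup>2 * E * (K * exp K) + (Kg * c2 + 2 * B * c2)"
  define c4 where "c4 = (2 * B)\<^sup>2 * E * exp K + 2 * B * c2"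
  define C where "C = max c4 (2 * (exp K * c2\<^sup>2) + D * c3)"
  have K0: "0 \<le> K" using nn by (simp add: K_def)
  have E0: "0 < E" by (simp add: E_def)
  have "\<bar>ln l - t * m\<bar> \<le> c4 * t\<^sup>2 \<and>
      \<bar>h x - h (shift x) - t * (L G x - L G (shift x))\<bar> \<le> (2 * (exp K * c2\<^sup>2) + D * c3) * t\<^sup>2"
    if t: "\<bar>t\<bar> \<le> 1" and l: "0 < l" and h: "h \<in> Lip_Omega"
      and eig: "\<And>x. ruelle nu (\<lambda>x. f x + t * g x) (\<lambda>x. exp (h x)) x = l * exp (h x)"
    for t l h x
  proof -
    define s where "s = \<bar>t\<bar>"
    have s: "0 \<le> s" "s \<le> 1" using t by (auto simp: s_def)
    have "lip (Kf + s * Kg) (\<lambda>x. f x + t * g x)"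
      unfolding s_def by (intro lip_add Kf lip_cmult Kg)
    then have "lip K (\<lambda>x. f x + t * g x)"
      by (rule lip_mono) (use s nn in \<open>simp add: K_def mult_left_le_one_le\<close>)
    \<comment> \<open>This a priori bound is the same for all admissible \<open>t\<close>,
      \<open>l\<close> and \<open>h\<close>; the uniformity of \<open>C\<close> starts here.\<close>
    then have hK: "lip K h" by (rule log_eigenfunction_lip[OF _ h l eig])
    define I where "I = (\<integral>x. exp (h x) \<partial>mu)"
    have I: "0 < I"
    proof -
      have "exp (h undefined - K) \<le> exp (h y)" for y
        using lip_le[OF hK, of undefined y] by simp
      then have "(\<integral>y. exp (h undefined - K) \<partial>mu) \<le> I"
        unfolding I_def by (intro integral_mono mu_integrable Lip_exp h Lip_const)
      then show ?thesis using exp_gt_zero[of "h undefined - K"] by (simp del: exp_gt_zero)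
    qed
    \<comment> \<open>A constant cancels in \<open>h x - h (shift x)\<close>, so \<open>h\<close>
      may be translated to give \<open>u = exp \<eta>\<close> mean 1. As the oscillation is at most
      \<open>K\<close>, this forces \<open>\<bar>\<eta> x\<bar> \<le> K\<close>.\<close>
    define \<eta> where "\<eta> = (\<lambda>x. h x + - ln I)"
    have \<eta>K: "lip K \<eta>" unfolding \<eta>_def by (rule lip_add_const[OF hK])
    have \<eta>L: "\<eta> \<in> Lip_Omega" by (rule lip_imp_Lip_Omega[OF \<eta>K])
    define u where "u = (\<lambda>x. exp (\<eta> x))"
    have uL: "u \<in> Lip_Omega" unfolding u_def by (rule Lip_exp[OF \<eta>L])
    have u_eq: "u x = inverse I * exp (h x)" for x
      using I by (simp add: u_def \<eta>_def exp_diff field_simps)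
    have u1: "(\<integral>x. u x \<partial>mu) = 1"
      using I by (simp add: u_eq flip: I_def)
    have \<eta>b: "\<bar>\<eta> x\<bar> \<le> K" for x
    proof -
      have 1: "exp (\<eta> x - K) \<le> u y" "u y \<le> exp (\<eta> x + K)" for y
        using lip_le[OF \<eta>K, of x y] by (auto simp: u_def)
      have "exp (\<eta> x - K) \<le> 1"
        using integral_mono[OF mu_integrable[OF Lip_const] mu_integrable[OF uL] 1(1)] u1 by simp
      moreover have "1 \<le> exp (\<eta> x + K)"
        using integral_mono[OF mu_integrable[OF uL] mu_integrable[OF Lip_const] 1(2)] u1 by simp
      ultimately show ?thesis by auto
    qed
    have ulip: "lip (K * exp K) u" unfolding u_def by (rule lip_exp[OF \<eta>K \<eta>b])
    have ub: "exp (- K) \<le> u x" "\<bar>u x\<bar> \<le> exp K" for x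
      using \<eta>b[of x] by (auto simp: u_def abs_le_iff)
    define k where "k = (\<lambda>x. t * g x + - ln l)"
    have exp_k: "exp (k x) = inverse l * exp (t * g x)" for x
      using l by (simp add: k_def exp_diff field_simps)
    \<comment> \<open>Dividing by \<open>l\<close> moves the eigenvalue into \<open>k\<close> and
      makes \<open>u\<close> a fixed point of an operator expressed through the unperturbed
      \<open>L\<close>.\<close>
    have Lu: "L (\<lambda>x. exp (k x) * u x) x = u x" for x
    proof -
      have "L (\<lambda>x. exp (k x) * u x) x = (\<integral>a. inverse (I * l) * (exp (f (case_nat a x) + t * g (case_nat a x)) * exp (h (case_nat a x))) \<partial>nu)"
        unfolding ruelle_def
        by (intro Bochner_Integration.integral_cong) (simp_all add: exp_k u_eq exp_add)
      also have "\<dots> = inverse (I * l) * (l * exp (h x))"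
        using eig[of x] by (simp add: ruelle_def)
      also have "\<dots> = u x" using l I by (simp add: u_eq)
      finally show ?thesis .
    qed
    have lk: "lip (s * Kg) k"
      unfolding k_def s_def by (intro lip_add_const lip_cmult Kg)
    have kL: "k \<in> Lip_Omega" by (rule lip_imp_Lip_Omega[OF lk])
    have tg: "\<bar>t * g x\<bar> \<le> s * B" for x
      using mult_mono[OF order_refl[of s] B(2)[of x]] s by (simp add: abs_mult s_def)
    have gtL: "(\<lambda>x. exp (t * g x) * u x) \<in> Lip_Omega"
      using g uL by (intro Lip_mult Lip_exp Lip_const)
    have l_eq: "(\<integral>x. exp (t * g x) * u x \<partial>mu) = l"
    proof -
      have "(\<integral>x. exp (t * g x) * u x \<partial>mu) = (\<integral>x. l * (exp (k x) * u x) \<partial>mu)"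
        using l by (simp add: exp_k mult.assoc)
      also have "\<dots> = l * (\<integral>x. exp (k x) * u x \<partial>mu)" by simp
      also have "(\<integral>x. exp (k x) * u x \<partial>mu) = (\<integral>x. u x \<partial>mu)"
        using integral_L[of "\<lambda>x. exp (k x) * u x"] kL uL Lip_mult Lip_exp by (simp add: Lu)
      finally show ?thesis using u1 by simp
    qed
    \<comment> \<open>By \<open>l_eq\<close>, \<open>l\<close> is the average of
      \<open>exp (t * g x)\<close> for the probability with density \<open>u\<close>, so it obeys
      the same two bounds as that function.\<close>
    have "\<bar>ln l\<bar> \<le> s * B"
    proof -
      have 1: "exp (- (s * B)) * u y \<le> exp (t * g y) * u y" "exp (t * g y) * u y \<le> exp (s * B) * u y" for y
        using tg[of y] by (auto simp: u_def)
      have "exp (- (s * B)) \<le> l"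
        using integral_mono[OF mu_integrable[OF Lip_mult[OF Lip_const uL]] mu_integrable[OF gtL] 1(1)]
        by (simp add: u1 l_eq)
      moreover have "l \<le> exp (s * B)"
        using integral_mono[OF mu_integrable[OF gtL] mu_integrable[OF Lip_mult[OF Lip_const uL]] 1(2)]
        by (simp add: u1 l_eq)
      ultimately show ?thesis
        using l ln_le_cancel_iff[of l "exp (s * B)"] ln_ge_iff[of l "- (s * B)"] by (simp add: abs_le_iff)
    qed
    then have kb: "\<bar>k x\<bar> \<le> 2 * B * s" for x
      using tg[of x] abs_triangle_ineq4[of "t * g x" "ln l"] by (simp add: k_def algebra_simps)
    have "exp (2 * B * s) \<le> E" using s B(1) by (simp add: E_def mult_left_le)
    have e1: "lip (s * Kg * E) (\<lambda>x. exp (k x))"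
      using lip_mono[OF lip_exp[OF lk kb]] \<open>exp (2 * B * s) \<le> E\<close> s nn by (simp add: mult_left_mono)
    have e1': "lip (s * Kg * E) (\<lambda>x. exp (k x) - 1)"
      using lip_add_const[OF e1, of "- 1"] by simp
    have e1b: "\<bar>exp (k x) - 1\<bar> \<le> 2 * B * s * E" for x
      using abs_exp_minus_one_le[OF kb[of x]] mult_left_mono[OF \<open>exp (2 * B * s) \<le> E\<close>, of "2 * B * s"] s B(1)
      by simp
    have e2: "lip (s * Kg * (2 * B * s) * E) (\<lambda>x. exp (k x) - 1 - k x)"
      using lip_mono[OF lip_exp_remainder[OF lk kb]] \<open>exp (2 * B * s) \<le> E\<close> s nn B(1) by (simp add: mult_left_mono)
    have e2b: "\<bar>exp (k x) - 1 - k x\<bar> \<le> (2 * B * s)\<^sup>2 * E" for x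
      using exp_remainder_le[OF kb[of x]] mult_left_mono[OF \<open>exp (2 * B * s) \<le> E\<close>, of "(2 * B * s)\<^sup>2"]
      by simp
    define q where "q = (\<lambda>x. (exp (k x) - 1) * u x)"
    have qlip: "lip (c1 * s) q"
    proof -
      have "lip (s * Kg * E * exp K + 2 * B * s * E * (K * exp K)) q"
        unfolding q_def by (rule lip_mult[OF e1' e1b ulip ub(2)])
      then show ?thesis by (simp add: c1_def algebra_simps)
    qed
    have qL: "q \<in> Lip_Omega" by (rule lip_imp_Lip_Omega[OF qlip])
    define z where "z = (\<lambda>x. u x - 1)"
    have zL: "z \<in> Lip_Omega" unfolding z_def by (intro Lip_diff uL Lip_const)
    have ekL: "(\<lambda>x. exp (k x) * u x) \<in> Lip_Omega" by (intro Lip_mult Lip_exp kL uL)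
    have zq: "z x - L z x = L q x" for x
    proof -
      have "L q x = L (\<lambda>x. exp (k x) * u x - u x) x"
        by (simp add: q_def left_diff_distrib)
      also have "\<dots> = u x - L u x"
        by (simp add: ruelle_diff[OF f_Lip ekL uL] Lu)
      also have "\<dots> = z x - L z x"
        unfolding z_def by (simp add: ruelle_diff[OF f_Lip uL Lip_const])
      finally show ?thesis by simp
    qed
    have zlip: "lip (c2 * s) z"
      using D(2)[OF zL qlip zq] by (simp add: c2_def mult_ac)
    have z0: "(\<integral>x. z x \<partial>mu) = 0" using uL by (simp add: z_def mu_integrable u1)
    have zb: "\<bar>z x\<bar> \<le> c2 * s" for x by (rule mean_zero_bound[OF zlip z0])
    \<comment> \<open>With \<open>u = 1 + z\<close> one gets \<open>q = k + r\<close>. Both summands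
      of \<open>r\<close> are of second order: an exponential remainder, and a product of two
      quantities of order \<open>t\<close>.\<close>
    define r where "r = (\<lambda>x. (exp (k x) - 1 - k x) * u x + k x * z x)"
    have rlip: "lip (c3 * t\<^sup>2) r"
    proof -
      have "lip ((s * Kg * (2 * B * s) * E * exp K + (2 * B * s)\<^sup>2 * E * (K * exp K)) +
          (s * Kg * (c2 * s) + 2 * B * s * (c2 * s))) r"
        unfolding r_def by (intro lip_add lip_mult[OF e2 e2b ulip ub(2)] lip_mult[OF lk kb zlip zb])
      moreover have "t\<^sup>2 = s * s" by (simp add: s_def power2_eq_square flip: abs_mult)
      ultimately show ?thesis by (simp add: c3_def algebra_simps power2_eq_square)
    qed
    have rL: "r \<in> Lip_Omega" by (rule lip_imp_Lip_Omega[OF rlip])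
    have rb: "\<bar>r x\<bar> \<le> c4 * t\<^sup>2" for x
    proof -
      have "\<bar>r x\<bar> \<le> \<bar>exp (k x) - 1 - k x\<bar> * \<bar>u x\<bar> + \<bar>k x\<bar> * \<bar>z x\<bar>"
        unfolding r_def by (metis abs_mult abs_triangle_ineq)
      also have "\<dots> \<le> ((2 * B * s)\<^sup>2 * E) * exp K + (2 * B * s) * (c2 * s)"
        using s B(1) E0 by (intro add_mono mult_mono e2b ub(2) kb zb) auto
      also have "\<dots> = c4 * (s * s)" by (simp add: c4_def algebra_simps power2_eq_square)
      finally show ?thesis by (simp add: s_def power2_eq_square flip: abs_mult)
    qed
    have q_eq: "q x = r x + k x" for x
      by (simp add: q_def r_def z_def algebra_simps)
    \<comment> \<open>The mean of \<open>k\<close> is \<open>t * m - ln l\<close>, so vanishing of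
      the mean of \<open>q = r + k\<close> expresses \<open>ln l - t * m\<close> as the mean of
      \<open>r\<close>.\<close>
    have "(\<integral>x. q x \<partial>mu) = 0"
    proof -
      have "(\<integral>x. q x \<partial>mu) = (\<integral>x. exp (k x) * u x - u x \<partial>mu)"
        by (simp add: q_def left_diff_distrib)
      also have "\<dots> = (\<integral>x. exp (k x) * u x \<partial>mu) - (\<integral>x. u x \<partial>mu)"
        by (intro Bochner_Integration.integral_diff mu_integrable ekL uL)
      also have "(\<integral>x. exp (k x) * u x \<partial>mu) = (\<integral>x. u x \<partial>mu)"
        using integral_L[OF ekL] by (simp add: Lu)
      finally show ?thesis by simp
    qed
    moreover have "(\<integral>x. q x \<partial>mu) = (\<integral>x. r x \<partial>mu) + (t * m - ln l)"
      unfolding q_eq using rL g by (simp add: k_def mu_integrable m_def)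
    ultimately have "ln l - t * m = (\<integral>x. r x \<partial>mu)" by simp
    then have first: "\<bar>ln l - t * m\<bar> \<le> c4 * t\<^sup>2"
      using integral_bound[OF rL rb] by simp
    \<comment> \<open>\<open>y\<close> is the first-order error of \<open>z\<close>. It solves the
      coboundary equation with \<open>qq\<close>, which differs from \<open>r\<close> by a constant,
      so its Lipschitz constant is of order \<open>t\<^sup>2\<close>. That suffices, since only
      \<open>y x - y (shift x)\<close> enters the conclusion.\<close>
    define y where "y = (\<lambda>x. z x - t * L G x)"
    define qq where "qq = (\<lambda>x. q x - t * (g x - m))"
    have LGL: "(\<lambda>x. t * L G x) \<in> Lip_Omega" by (intro Lip_mult Lip_const L_Lip G)
    have yL: "y \<in> Lip_Omega" unfolding y_def by (intro Lip_diff zL LGL)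
    have "qq = (\<lambda>x. r x + (t * m - ln l))"
      by (auto simp: qq_def q_eq k_def algebra_simps)
    then have "lip (c3 * t\<^sup>2) qq" using lip_add_const[OF rlip] by simp
    moreover have "y x - L y x = L qq x" for x
    proof -
      have "L y x = L z x - t * L (L G) x"
        unfolding y_def by (simp add: ruelle_diff[OF f_Lip zL LGL] ruelle_cmult)
      moreover have "L qq x = L q x - t * L (\<lambda>x. g x - m) x"
        unfolding qq_def using g
        by (subst ruelle_diff[OF f_Lip qL]) (auto simp: ruelle_cmult intro!: Lip_mult)
      moreover have "L (\<lambda>x. g x - m) x = L (\<lambda>x. G x - L G x) x"
        using G(2) by (simp add: m_def)
      moreover have "\<dots> = L G x - L (L G) x"
        by (rule ruelle_diff[OF f_Lip G(1) L_Lip[OF G(1)]])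
      ultimately show ?thesis using zq[of x] by (simp add: y_def algebra_simps)
    qed
    ultimately have ylip: "lip (D * (c3 * t\<^sup>2)) y" by (rule D(2)[OF yL])
    \<comment> \<open>Replacing \<open>ln u\<close> by \<open>u - 1\<close> costs at most
      \<open>(u - 1)\<^sup>2 / u\<close>.\<close>
    have log: "\<bar>\<eta> x - z x\<bar> \<le> exp K * c2\<^sup>2 * t\<^sup>2" for x
    proof -
      have u0: "0 < u x" by (simp add: u_def)
      have "\<eta> x \<le> z x"
        using exp_ge_add_one_self[of "\<eta> x"] unfolding z_def u_def by linarith
      moreover have "z x - \<eta> x \<le> exp K * (c2\<^sup>2 * t\<^sup>2)"
      proof -
        have "1 - \<eta> x \<le> inverse (u x)"
          using exp_ge_add_one_self[of "- \<eta> x"] unfolding u_def exp_minus[symmetric] by linarith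
        then have "z x - \<eta> x \<le> u x - 2 + inverse (u x)" by (simp add: z_def)
        also have "\<dots> = inverse (u x) * (z x)\<^sup>2"
          using u0 by (simp add: z_def power2_eq_square field_simps)
        also have "\<dots> \<le> exp K * (c2 * s)\<^sup>2"
        proof (intro mult_mono)
          show "inverse (u x) \<le> exp K" using \<eta>b[of x] by (simp add: u_def flip: exp_minus)
          show "(z x)\<^sup>2 \<le> (c2 * s)\<^sup>2"
            using zb[of x] by (simp add: abs_le_square_iff[symmetric])
        qed auto
        finally show ?thesis by (simp add: power_mult_distrib s_def)
      qed
      ultimately show ?thesis by simp
    qed
    have "h x - h (shift x) - t * (L G x - L G (shift x))
        = (\<eta> x - z x) - (\<eta> (shift x) - z (shift x)) + (y x - y (shift x))"
      by (simp add: \<eta>_def y_def algebra_simps)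
    then have "\<bar>h x - h (shift x) - t * (L G x - L G (shift x))\<bar>
        \<le> exp K * c2\<^sup>2 * t\<^sup>2 + exp K * c2\<^sup>2 * t\<^sup>2 + D * (c3 * t\<^sup>2)"
      using log[of x] log[of "shift x"] lip_le[OF ylip, of x "shift x"] by linarith
    then show ?thesis using first by (simp add: algebra_simps)
  qed
  note bounds = this
  have C: "c4 * t\<^sup>2 \<le> C * t\<^sup>2" "(2 * (exp K * c2\<^sup>2) + D * c3) * t\<^sup>2 \<le> C * t\<^sup>2" for t
    by (auto simp: C_def intro!: mult_right_mono)
  show ?thesis
  proof (intro exI[of _ C] allI impI)
    fix t l :: real and h x
    assume 1: "\<bar>t\<bar> \<le> 1" "0 < l" "h \<in> Lip_Omega"
      and 2: "\<forall>x. ruelle nu (\<lambda>x. f x + t * g x) (\<lambda>x. exp (h x)) x = l * exp (h x)"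
    from bounds[OF 1 spec[OF 2], of x]
    show "\<bar>ln l - t * (\<integral>y. g y \<partial>mu)\<bar> \<le> C * t\<^sup>2 \<and>
      \<bar>h x - h (shift x) - t * (L G x - L G (shift x))\<bar> \<le> C * t\<^sup>2"
      using C[of t] unfolding m_def by (meson order_trans)
  qed
qed

end

section \<open>Linear response of the invariant measure\<close>

context normalized_potential
begin

text \<open>The operator of \<open>f'\<close> preserves \<open>mu'\<close>-integrals, so
  \<open>H\<close> may be replaced by its image under it; and that operator is \<open>L\<close> with
  the extra weight \<open>exp (f' x - f x)\<close>.\<close>

lemma integral_coboundary:
  assumes f': "normalized_potential nu f' mu'" and H: "H \<in> Lip_Omega"
  shows "(\<integral>x. H x - L H x \<partial>mu') = (\<integral>x. L (\<lambda>x. (exp (f' x - f x) - 1) * H x) x \<partial>mu')"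
proof -
  interpret f': normalized_potential nu f' mu' by (rule f')
  have eL: "(\<lambda>x. exp (f' x - f x) * H x) \<in> Lip_Omega"
    by (intro Lip_mult Lip_exp Lip_diff f'.f_Lip f_Lip H)
  have "L (\<lambda>x. (exp (f' x - f x) - 1) * H x) x = f'.L H x - L H x" for x
  proof -
    have "L (\<lambda>x. (exp (f' x - f x) - 1) * H x) x = L (\<lambda>x. exp (f' x - f x) * H x) x - L H x"
      using ruelle_diff[OF f_Lip eL H] by (simp add: left_diff_distrib)
    also have "L (\<lambda>x. exp (f' x - f x) * H x) x = f'.L H x"
      unfolding ruelle_def by (simp add: mult.assoc[symmetric] mult_exp_exp)
    finally show ?thesis .
  qed
  then show ?thesis
    using H by (simp add: f'.mu_integrable f'.L_Lip L_Lip f'.integral_L)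
qed

text \<open>As \<open>L \<psi> = 0\<close>, invariance of \<open>mu\<close> makes
  \<open>\<psi>\<close> orthogonal to Lipschitz functions of \<open>shift x\<close>, so one factor
  \<open>\<psi>\<close> may be traded for \<open>G\<close>.\<close>

lemma variance_eq:
  assumes G: "G \<in> Lip_Omega"
  defines "\<psi> \<equiv> \<lambda>x. G x - L G (shift x)"
  shows "(\<integral>x. \<psi> x * G x \<partial>mu) = (\<integral>x. (\<psi> x)\<^sup>2 \<partial>mu)"
proof -
  have LGs: "(\<lambda>x. L G (shift x)) \<in> Lip_Omega" by (intro Lip_shift L_Lip G)
  have \<psi>: "\<psi> \<in> Lip_Omega" unfolding \<psi>_def by (intro Lip_diff G LGs)
  have "L \<psi> x = 0" for x
    using ruelle_diff[OF f_Lip G LGs, of x] ruelle_mult_shift[of f "L G" "\<lambda>_. 1" x]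
    by (simp add: \<psi>_def)
  then have "(\<integral>x. L G (shift x) * \<psi> x \<partial>mu) = 0"
    using integral_L[OF Lip_mult[OF LGs \<psi>]] by (simp add: ruelle_mult_shift)
  moreover have "(\<integral>x. (\<psi> x)\<^sup>2 \<partial>mu) = (\<integral>x. \<psi> x * G x - L G (shift x) * \<psi> x \<partial>mu)"
    by (intro Bochner_Integration.integral_cong) (auto simp: \<psi>_def power2_eq_square algebra_simps)
  moreover have "\<dots> = (\<integral>x. \<psi> x * G x \<partial>mu) - (\<integral>x. L G (shift x) * \<psi> x \<partial>mu)"
    by (intro Bochner_Integration.integral_diff mu_integrable Lip_mult \<psi> G LGs)
  ultimately show ?thesis by simp
qed

text \<open>Writing \<open>g - \<integral>g d\<mu> = G - L G\<close> turns \<open>\<integral>g d\<mu>\<^sub>t - \<integral>g d\<mu>\<close> into the \<open>\<mu>\<^sub>t\<close>-integral of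
  \<open>L ((exp (f\<^sub>t - f) - 1) G)\<close>, which is already of order \<open>t\<close>; the same device applied to
  \<open>L (\<psi> G)\<close> allows \<open>\<mu>\<^sub>t\<close> to be replaced by \<open>\<mu>\<close> in the leading term.\<close>

lemma linear_response:
  assumes g: "g \<in> Lip_Omega" and G: "G \<in> Lip_Omega" "\<And>x. G x - L G x = g x - (\<integral>y. g y \<partial>mu)"
    and f': "\<And>t. normalized_potential nu (f' t) (mu' t)"
    and exp: "\<And>t x. \<bar>t\<bar> \<le> 1 \<Longrightarrow> \<bar>f' t x - f x - t * (G x - L G (shift x))\<bar> \<le> C * t\<^sup>2"
  obtains C' where "\<And>t. \<bar>t\<bar> \<le> 1 \<Longrightarrow>
    \<bar>(\<integral>x. g x \<partial>mu' t) - (\<integral>x. g x \<partial>mu) - t * (\<integral>x. (G x - L G (shift x))\<^sup>2 \<partial>mu)\<bar> \<le> C' * t\<^sup>2"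
proof -
  define \<psi> where "\<psi> = (\<lambda>x. G x - L G (shift x))"
  have \<psi>: "\<psi> \<in> Lip_Omega" unfolding \<psi>_def by (intro Lip_diff Lip_shift L_Lip G)
  define h where "h = L (\<lambda>x. \<psi> x * G x)"
  have \<psi>G: "(\<lambda>x. \<psi> x * G x) \<in> Lip_Omega" by (intro Lip_mult \<psi> G)
  have h: "h \<in> Lip_Omega" unfolding h_def by (rule L_Lip[OF \<psi>G])
  obtain H where H: "H \<in> Lip_Omega" "\<And>x. H x - L H x = h x - (\<integral>y. h y \<partial>mu)"
    using poisson_equation[OF h] by blast
  obtain B where B: "0 \<le> B" "\<And>x. \<bar>\<psi> x\<bar> \<le> B" using Lip_Omega_bounded[OF \<psi>] by blast
  obtain BG where BG: "0 \<le> BG" "\<And>x. \<bar>G x\<bar> \<le> BG" using Lip_Omega_bounded[OF G(1)] by blast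
  obtain BH where BH: "0 \<le> BH" "\<And>x. \<bar>H x\<bar> \<le> BH" using Lip_Omega_bounded[OF H(1)] by blast
  have C: "0 \<le> C" using exp[of 1 undefined] by simp
  \<comment> \<open>Since \<open>t\<^sup>2 \<le> \<bar>t\<bar>\<close> in the range considered,
    \<open>c\<close> bounds \<open>f' t x - f x\<close> relative to \<open>\<bar>t\<bar>\<close>;
    \<open>c'\<close> bounds \<open>exp (f' t x - f x) - 1 - t * \<psi> x\<close> relative to
    \<open>t\<^sup>2\<close>.\<close>
  define c where "c = B + C"
  define c' where "c' = c\<^sup>2 * exp c + C"
  have c: "0 \<le> c" using B(1) C by (simp add: c_def)
  have "\<bar>(\<integral>x. g x \<partial>mu' t) - (\<integral>x. g x \<partial>mu) - t * (\<integral>x. (\<psi> x)\<^sup>2 \<partial>mu)\<bar>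
      \<le> (c' * BG + c * exp c * BH) * t\<^sup>2" if t: "\<bar>t\<bar> \<le> 1" for t
  proof -
    interpret f': normalized_potential nu "f' t" "mu' t" by (rule f')
    define k where "k = (\<lambda>x. f' t x - f x)"
    have kL: "k \<in> Lip_Omega" unfolding k_def by (intro Lip_diff f'.f_Lip f_Lip)
    have ekL: "(\<lambda>x. (exp (k x) - 1) * F x) \<in> Lip_Omega" if "F \<in> Lip_Omega" for F
      by (intro Lip_mult Lip_diff Lip_exp Lip_const kL that)
    have t2: "t\<^sup>2 = \<bar>t\<bar> * \<bar>t\<bar>" by (simp add: power2_eq_square)
    have tt: "t\<^sup>2 \<le> \<bar>t\<bar>" unfolding t2 using t by (intro mult_left_le) auto
    have kb: "\<bar>k x\<bar> \<le> c * \<bar>t\<bar>" for x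
    proof -
      have "\<bar>k x\<bar> \<le> \<bar>t\<bar> * \<bar>\<psi> x\<bar> + C * t\<^sup>2"
        using exp[OF t, of x] unfolding k_def \<psi>_def abs_mult[symmetric] by linarith
      also have "\<dots> \<le> \<bar>t\<bar> * B + C * \<bar>t\<bar>"
        by (intro add_mono mult_left_mono B tt C) auto
      finally show ?thesis by (simp add: c_def algebra_simps)
    qed
    have cexp: "exp (c * \<bar>t\<bar>) \<le> exp c" using c t by (simp add: mult_left_le)
    have k1: "\<bar>exp (k x) - 1\<bar> \<le> c * exp c * \<bar>t\<bar>" for x
    proof -
      have "\<bar>exp (k x) - 1\<bar> \<le> c * \<bar>t\<bar> * exp (c * \<bar>t\<bar>)" by (rule abs_exp_minus_one_le[OF kb])
      also have "\<dots> \<le> c * \<bar>t\<bar> * exp c" using c by (intro mult_left_mono cexp) auto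
      finally show ?thesis by (simp add: mult_ac)
    qed
    have k2: "\<bar>exp (k x) - 1 - t * \<psi> x\<bar> \<le> c' * t\<^sup>2" for x
    proof -
      have "\<bar>exp (k x) - 1 - k x\<bar> \<le> (c * \<bar>t\<bar>)\<^sup>2 * exp (c * \<bar>t\<bar>)" by (rule exp_remainder_le[OF kb])
      also have "\<dots> \<le> (c * \<bar>t\<bar>)\<^sup>2 * exp c" by (intro mult_left_mono cexp) auto
      also have "\<dots> = c\<^sup>2 * exp c * t\<^sup>2" by (simp add: power_mult_distrib)
      finally show ?thesis
        using exp[OF t, of x] unfolding c'_def k_def \<psi>_def distrib_right by linarith
    qed
    have "\<bar>(\<integral>x. h x \<partial>mu' t) - (\<integral>x. h x \<partial>mu)\<bar> \<le> c * exp c * \<bar>t\<bar> * BH"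
    proof -
      have "(\<integral>x. h x \<partial>mu' t) - (\<integral>x. h x \<partial>mu) = (\<integral>x. H x - L H x \<partial>mu' t)"
        unfolding H(2) using h by (simp add: f'.mu_integrable)
      also have "\<dots> = (\<integral>x. L (\<lambda>x. (exp (k x) - 1) * H x) x \<partial>mu' t)"
        unfolding k_def by (rule integral_coboundary[OF f' H(1)])
      also have "\<bar>\<dots>\<bar> \<le> c * exp c * \<bar>t\<bar> * BH"
      proof (intro f'.integral_bound L_Lip L_bound ekL H(1))
        show "\<bar>(exp (k x) - 1) * H x\<bar> \<le> c * exp c * \<bar>t\<bar> * BH" for x
          unfolding abs_mult using c by (intro mult_mono k1 BH) auto
      qed
      finally show ?thesis .
    qed
    then have "\<bar>t * ((\<integral>x. h x \<partial>mu' t) - (\<integral>x. h x \<partial>mu))\<bar> \<le> \<bar>t\<bar> * (c * exp c * \<bar>t\<bar> * BH)"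
      unfolding abs_mult by (intro mult_left_mono) auto
    also have "\<dots> = c * exp c * BH * t\<^sup>2"
      unfolding t2 by (simp only: mult_ac)
    finally have 1: "\<bar>t * (\<integral>x. h x \<partial>mu' t) - t * (\<integral>x. h x \<partial>mu)\<bar> \<le> c * exp c * BH * t\<^sup>2"
      by (simp add: right_diff_distrib)
    have "(\<integral>x. g x \<partial>mu' t) - (\<integral>x. g x \<partial>mu) = (\<integral>x. G x - L G x \<partial>mu' t)"
      unfolding G(2) using g by (simp add: f'.mu_integrable)
    also have "\<dots> = (\<integral>x. L (\<lambda>x. (exp (k x) - 1) * G x) x \<partial>mu' t)"
      unfolding k_def by (rule integral_coboundary[OF f' G(1)])
    also have "\<dots> - t * (\<integral>x. h x \<partial>mu' t) = (\<integral>x. L (\<lambda>x. (exp (k x) - 1) * G x) x - t * h x \<partial>mu' t)"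
      using h L_Lip[OF ekL[OF G(1)]] by (simp add: f'.mu_integrable)
    also have "\<dots> = (\<integral>x. L (\<lambda>x. (exp (k x) - 1) * G x - t * (\<psi> x * G x)) x \<partial>mu' t)"
      unfolding h_def ruelle_cmult[symmetric]
      by (simp add: ruelle_diff[OF f_Lip ekL[OF G(1)] Lip_mult[OF Lip_const \<psi>G]])
    also have "\<bar>\<dots>\<bar> \<le> c' * t\<^sup>2 * BG"
    proof (intro f'.integral_bound L_Lip L_bound Lip_diff ekL G(1) Lip_mult[OF Lip_const \<psi>G])
      fix x
      have "\<bar>(exp (k x) - 1) * G x - t * (\<psi> x * G x)\<bar> = \<bar>exp (k x) - 1 - t * \<psi> x\<bar> * \<bar>G x\<bar>"
        by (simp add: algebra_simps flip: abs_mult)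
      also have "\<dots> \<le> c' * t\<^sup>2 * BG"
        using C by (intro mult_mono k2 BG) (auto simp: c'_def)
      finally show "\<bar>(exp (k x) - 1) * G x - t * (\<psi> x * G x)\<bar> \<le> c' * t\<^sup>2 * BG" .
    qed
    finally have 2: "\<bar>(\<integral>x. g x \<partial>mu' t) - (\<integral>x. g x \<partial>mu) - t * (\<integral>x. h x \<partial>mu' t)\<bar> \<le> c' * t\<^sup>2 * BG" .
    have "(\<integral>x. h x \<partial>mu) = (\<integral>x. (\<psi> x)\<^sup>2 \<partial>mu)"
      unfolding h_def using integral_L[OF \<psi>G] variance_eq[OF G(1)] by (simp add: \<psi>_def)
    then show ?thesis using 1 2 by (simp add: algebra_simps)
  qed
  then show ?thesis using that unfolding \<psi>_def by blast
qed

end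

section \<open>Normalization of the perturbed potentials\<close>

context shift_space
begin

lemma ruelle_normalize:
  assumes "0 < l"
  shows "ruelle nu (\<lambda>x. F x + h x - h (shift x) - ln l) k x =
    exp (- h x) / l * ruelle nu F (\<lambda>x. exp (h x) * k x) x"
proof -
  have "ruelle nu (\<lambda>x. F x + h x - h (shift x) - ln l) k x =
      (\<integral>a. exp (- h x) / l * (exp (F (case_nat a x)) * (exp (h (case_nat a x)) * k (case_nat a x))) \<partial>nu)"
    unfolding ruelle_def using assms
    by (intro Bochner_Integration.integral_cong) (auto simp: exp_diff exp_add exp_minus field_simps)
  then show ?thesis by (simp add: ruelle_def)
qed

text \<open>Conjugating by \<open>exp h\<close> and dividing by \<open>l\<close> turns the
  eigenfunction into 1 and \<open>rho\<close> into the measure of density \<open>exp h\<close>, a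
  probability by the normalization in \<open>rpf_triple\<close>.\<close>

lemma normalized_potential_normalize:
  assumes F: "F \<in> Lip_Omega" and rpf: "rpf_triple nu F l (\<lambda>x. exp (h x)) rho"
  shows "normalized_potential nu (\<lambda>x. F x + h x - h (shift x) - ln l)
    (density rho (\<lambda>x. ennreal (exp (h x))))"
proof -
  let ?f = "\<lambda>x. F x + h x - h (shift x) - ln l" and ?mu = "density rho (\<lambda>x. ennreal (exp (h x)))"
  have l: "0 < l" and ehL: "(\<lambda>x. exp (h x)) \<in> Lip_Omega"
    and eig: "\<And>x. ruelle nu F (\<lambda>x. exp (h x)) x = l * exp (h x)"
    and rho: "borel_probability rho" and int: "(\<integral>x. exp (h x) \<partial>rho) = 1"
    and dual: "\<And>k. k \<in> Lip_Omega \<Longrightarrow> (\<integral>x. ruelle nu F k x \<partial>rho) = l * (\<integral>x. k x \<partial>rho)"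
    using rpf Lip_Omega_continuous[OF compact_M diameter_M]
    by (auto simp: rpf_triple_def dual_eigenmeasure_def)
  have hL: "h \<in> Lip_Omega" by (rule lip_log[OF ehL])
  have fL: "?f \<in> Lip_Omega" by (intro Lip_diff Lip_add F hL Lip_shift[OF hL] Lip_const)
  have meas: "k \<in> borel_measurable rho" if "k \<in> Lip_Omega" for k
    using Lip_integrable[OF rho that] by (rule borel_measurable_integrable)
  have dens: "(\<integral>x. k x \<partial>?mu) = (\<integral>x. exp (h x) * k x \<partial>rho)" if "k \<in> Lip_Omega" for k
    using integral_real_density[OF meas[OF ehL] _ meas[OF that]] by simp
  show ?thesis
  proof
    show "?f \<in> normalized_potentials nu"
      unfolding normalized_potentials_def using fL l
      by (simp add: ruelle_normalize eig flip: exp_add)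
    have "emeasure ?mu (space ?mu) = 1"
    proof -
      have "emeasure ?mu (space ?mu) = (\<integral>\<^sup>+x. ennreal (exp (h x)) \<partial>rho)"
        using meas[OF ehL] by (subst emeasure_density) (auto intro!: nn_integral_cong)
      also have "\<dots> = 1"
        using nn_integral_eq_integral[OF Lip_integrable[OF rho ehL]] int by simp
      finally show ?thesis .
    qed
    then show "borel_probability ?mu"
      using rho by (auto simp: borel_probability_def intro: prob_spaceI)
    fix k :: "(nat \<Rightarrow> 'a) \<Rightarrow> real"
    assume k: "k \<in> Lip_Omega"
    have ehk: "(\<lambda>x. exp (h x) * k x) \<in> Lip_Omega" by (rule Lip_mult[OF ehL k])
    have "(\<integral>x. ruelle nu ?f k x \<partial>?mu) = (\<integral>x. exp (h x) * ruelle nu ?f k x \<partial>rho)"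
      by (rule dens[OF ruelle_Lip[OF fL k]])
    also have "\<dots> = (\<integral>x. ruelle nu F (\<lambda>x. exp (h x) * k x) x / l \<partial>rho)"
      using l by (intro Bochner_Integration.integral_cong) (simp_all add: ruelle_normalize exp_minus)
    also have "\<dots> = (\<integral>x. exp (h x) * k x \<partial>rho)"
      using l by (simp add: dual[OF ehk])
    also have "\<dots> = (\<integral>x. k x \<partial>?mu)" by (rule dens[OF k, symmetric])
    finally show "(\<integral>x. ruelle nu ?f k x \<partial>?mu) = (\<integral>x. k x \<partial>?mu)" .
  qed
qed

end

section \<open>The first and second derivatives of the pressure\<close>

theorem theorem26:
  fixes nu :: "'a::metric_space measure"
    and f g :: "(nat \<Rightarrow> 'a) \<Rightarrow> real"
    and mu :: "(nat \<Rightarrow> 'a) measure"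
    and phi :: "real \<Rightarrow> (nat \<Rightarrow> 'a) \<Rightarrow> real"
    and lam :: "real \<Rightarrow> real"
    and rho :: "real \<Rightarrow> (nat \<Rightarrow> 'a) measure"
    and p :: "real \<Rightarrow> real"
  assumes "compact (UNIV :: 'a set)"
    and "diameter (UNIV :: 'a set) = 1"
    and "borel_probability nu"
    and "full_support nu"
    and "f \<in> normalized_potentials nu"
    and "g \<in> Lip_Omega"
    and "dual_eigenmeasure nu f 1 mu"
    and "\<And>t. rpf_triple nu (\<lambda>x. f x + t * g x) (lam t) (\<lambda>x. exp (phi t x)) (rho t)"
    and p_def: "\<And>t. p t = pressure nu (\<lambda>x. f x + t * g x)"
  shows "(\<forall>\<^sub>F t in nhds 0. p differentiable (at t)) \<and>
    deriv p differentiable (at 0) \<and>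
    (\<forall>x. (\<lambda>t. phi t x - phi t (shift x)) differentiable (at 0)) \<and>
    integrable mu (\<lambda>x. (g x - (\<integral>y. g y \<partial>mu) + deriv (\<lambda>t. phi t x - phi t (shift x)) 0)\<^sup>2) \<and>
    deriv (deriv p) 0 =
      (\<integral>x. (g x - (\<integral>y. g y \<partial>mu) + deriv (\<lambda>t. phi t x - phi t (shift x)) 0)\<^sup>2 \<partial>mu)"
proof -
  note rpf = assms(8)
  interpret shift_space nu
    using assms by unfold_locales
  interpret normalized_potential nu f mu
    using assms Lip_Omega_continuous[OF assms(1,2)]
    by unfold_locales (auto simp: dual_eigenmeasure_def)
  have g: "g \<in> Lip_Omega" by fact
  have fL: "(\<lambda>x. f x + t * g x) \<in> Lip_Omega" for t
    by (intro Lip_add f_Lip Lip_mult Lip_const g)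
  have lam: "0 < lam t" and phi: "phi t \<in> Lip_Omega"
    and eig: "ruelle nu (\<lambda>x. f x + t * g x) (\<lambda>x. exp (phi t x)) x = lam t * exp (phi t x)" for t x
    using rpf[of t] lip_log by (auto simp: rpf_triple_def)
  have p: "p t = ln (lam t)" for t
    unfolding p_def pressure_def using rpf_eigenvalue_eq[OF assms(1,2) rpf] by simp
  define f' where "f' = (\<lambda>t x. f x + t * g x + phi t x - phi t (shift x) - ln (lam t))"
  define mu' where "mu' = (\<lambda>t. density (rho t) (\<lambda>x. ennreal (exp (phi t x))))"
  have norm': "normalized_potential nu (f' t) (mu' t)" for t
    unfolding f'_def mu'_def by (rule normalized_potential_normalize[OF fL rpf])
  \<comment> \<open>The second derivative needs \<open>deriv p\<close> near 0, so the expansion is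
    applied at every \<open>f' s\<close>. There \<open>exp (phi (s + t) x - phi s x)\<close> is an
    eigenfunction with eigenvalue \<open>lam (s + t) / lam s\<close>, whose logarithm is
    \<open>p (s + t) - p s\<close>.\<close>
  have deriv_p: "(p has_real_derivative (\<integral>x. g x \<partial>mu' s)) (at s)" for s
  proof -
    interpret f': normalized_potential nu "f' s" "mu' s" by (rule norm')
    obtain G where G: "G \<in> Lip_Omega" "\<And>x. G x - f'.L G x = g x - (\<integral>y. g y \<partial>mu' s)"
        "(\<integral>x. G x \<partial>mu' s) = 0"
      using f'.poisson_equation[OF g] by blast
    obtain C where C: "\<forall>t l h x. \<bar>t\<bar> \<le> 1 \<longrightarrow> 0 < l \<longrightarrow> h \<in> Lip_Omega \<longrightarrow>
      (\<forall>x. ruelle nu (\<lambda>x. f' s x + t * g x) (\<lambda>x. exp (h x)) x = l * exp (h x)) \<longrightarrow>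
      \<bar>ln l - t * (\<integral>y. g y \<partial>mu' s)\<bar> \<le> C * t\<^sup>2 \<and>
      \<bar>h x - h (shift x) - t * (f'.L G x - f'.L G (shift x))\<bar> \<le> C * t\<^sup>2"
      by (rule exE[OF f'.eigenpair_expansion[OF g G]])
    show ?thesis
    proof (rule has_derivative_quadratic_remainder)
      fix t :: real
      assume t: "\<bar>t\<bar> \<le> 1"
      have "ruelle nu (\<lambda>x. f' s x + t * g x) (\<lambda>x. exp (phi (s + t) x - phi s x)) x
          = lam (s + t) / lam s * exp (phi (s + t) x - phi s x)" for x
      proof -
        have "(\<lambda>x. f' s x + t * g x) = (\<lambda>x. (f x + (s + t) * g x) + phi s x - phi s (shift x) - ln (lam s))"
          by (auto simp: f'_def algebra_simps)
        then have "ruelle nu (\<lambda>x. f' s x + t * g x) (\<lambda>x. exp (phi (s + t) x - phi s x)) x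
          = exp (- phi s x) / lam s * ruelle nu (\<lambda>x. f x + (s + t) * g x)
              (\<lambda>x. exp (phi s x) * exp (phi (s + t) x - phi s x)) x"
          by (simp only: ruelle_normalize[OF lam, where F = "\<lambda>x. f x + (s + t) * g x" and h = "phi s"])
        also have "\<dots> = exp (- phi s x) / lam s * (lam (s + t) * exp (phi (s + t) x))"
          by (simp only: mult_exp_exp add_diff_cancel_left' add.commute[of "phi s _"] diff_add_cancel eig)
        also have "\<dots> = lam (s + t) / lam s * exp (phi (s + t) x - phi s x)"
          by (simp add: exp_diff exp_minus divide_simps)
        finally show ?thesis .
      qed
      from C[rule_format, OF t _ Lip_diff[OF phi phi] this]
      show "\<bar>p (s + t) - p s - t * (\<integral>x. g x \<partial>mu' s)\<bar> \<le> C * t\<^sup>2"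
        using lam by (simp add: p ln_div less_imp_neq[THEN not_sym])
    qed
  qed
  obtain G where G: "G \<in> Lip_Omega" "\<And>x. G x - L G x = g x - (\<integral>y. g y \<partial>mu)" "(\<integral>x. G x \<partial>mu) = 0"
    using poisson_equation[OF g] by blast
  define m where "m = (\<integral>y. g y \<partial>mu)"
  obtain C where C: "\<And>t x. \<bar>t\<bar> \<le> 1 \<Longrightarrow> \<bar>ln (lam t) - t * m\<bar> \<le> C * t\<^sup>2 \<and>
      \<bar>phi t x - phi t (shift x) - t * (L G x - L G (shift x))\<bar> \<le> C * t\<^sup>2"
  proof (rule exE[OF eigenpair_expansion[OF g G]])
    fix C
    assume "\<forall>t l h x. \<bar>t\<bar> \<le> 1 \<longrightarrow> 0 < l \<longrightarrow> h \<in> Lip_Omega \<longrightarrow>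
      (\<forall>x. ruelle nu (\<lambda>x. f x + t * g x) (\<lambda>x. exp (h x)) x = l * exp (h x)) \<longrightarrow>
      \<bar>ln l - t * (\<integral>y. g y \<partial>mu)\<bar> \<le> C * t\<^sup>2 \<and>
      \<bar>h x - h (shift x) - t * (L G x - L G (shift x))\<bar> \<le> C * t\<^sup>2"
    from that[OF this[folded m_def, rule_format, OF _ lam phi eig]] show thesis .
  qed
  \<comment> \<open>At \<open>t = 0\<close> the error bounds vanish, which replaces a separate
    uniqueness argument for the eigenpair of \<open>f\<close>.\<close>
  have lam0: "ln (lam 0) = 0" and phi0: "phi 0 x - phi 0 (shift x) = 0" for x
    using C[of 0 x] by auto
  have deriv_phi: "((\<lambda>t. phi t x - phi t (shift x)) has_real_derivative L G x - L G (shift x)) (at 0)" for x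
    by (rule has_derivative_quadratic_remainder[where C = C]) (use C phi0 in simp)
  \<comment> \<open>By the Poisson equation the left side is
    \<open>(G x - L G x) + (L G x - L G (shift x))\<close>, which telescopes.\<close>
  have \<psi>: "g x - (\<integral>y. g y \<partial>mu) + deriv (\<lambda>t. phi t x - phi t (shift x)) 0 = G x - L G (shift x)" for x
    using DERIV_imp_deriv[OF deriv_phi[of x]] G(2)[of x] by simp
  \<comment> \<open>Both sides are the derivative of \<open>p\<close> at 0, so \<open>mu' 0\<close>
    and \<open>mu\<close> agree on \<open>g\<close> without appeal to uniqueness of the invariant
    measure.\<close>
  have m0: "(\<integral>x. g x \<partial>mu' 0) = m"
  proof (rule DERIV_unique[OF deriv_p])
    show "(p has_real_derivative m) (at 0)"
      by (rule has_derivative_quadratic_remainder[where C = C]) (use C lam0 p in simp)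
  qed
  have f'_exp: "\<bar>f' t x - f x - t * (G x - L G (shift x))\<bar> \<le> 2 * C * t\<^sup>2" if "\<bar>t\<bar> \<le> 1" for t x
  proof -
    have "f' t x - f x - t * (G x - L G (shift x)) =
        (phi t x - phi t (shift x) - t * (L G x - L G (shift x))) - (ln (lam t) - t * m)"
      using arg_cong[OF G(2)[of x], of "\<lambda>a. t * a"] by (simp add: f'_def m_def algebra_simps)
    then show ?thesis using C[OF that, of x] by linarith
  qed
  obtain C' where C': "\<And>t. \<bar>t\<bar> \<le> 1 \<Longrightarrow>
    \<bar>(\<integral>x. g x \<partial>mu' t) - (\<integral>x. g x \<partial>mu) - t * (\<integral>x. (G x - L G (shift x))\<^sup>2 \<partial>mu)\<bar> \<le> C' * t\<^sup>2"
    using linear_response[OF g G(1,2) norm' f'_exp] by blast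
  have "((\<lambda>s. \<integral>x. g x \<partial>mu' s) has_real_derivative (\<integral>x. (G x - L G (shift x))\<^sup>2 \<partial>mu)) (at 0)"
    by (rule has_derivative_quadratic_remainder[where C = C']) (use C' m0 m_def in simp)
  moreover have "deriv p = (\<lambda>s. \<integral>x. g x \<partial>mu' s)"
    using DERIV_imp_deriv[OF deriv_p] by blast
  ultimately have second: "(deriv p has_real_derivative (\<integral>x. (G x - L G (shift x))\<^sup>2 \<partial>mu)) (at 0)"
    by simp
  have "integrable mu (\<lambda>x. (G x - L G (shift x))\<^sup>2)"
    unfolding power2_eq_square by (intro mu_integrable Lip_mult Lip_diff Lip_shift L_Lip G)
  moreover have "p differentiable (at t)" for t
    using deriv_p[of t] real_differentiable_def by blast
  moreover have "deriv p differentiable (at 0)"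
    using second real_differentiable_def by blast
  moreover have "(\<lambda>t. phi t x - phi t (shift x)) differentiable (at 0)" for x
    using deriv_phi[of x] real_differentiable_def by blast
  ultimately show ?thesis
    unfolding \<psi> using DERIV_imp_deriv[OF second] by simp
qed

end
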